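(* Let $\frac{d}{dt}x=f(x,u)$ be a $G$-invariant system with $G$-equivariant output $y=h(x,u)$. Then the following three statements hold: 1. There is an invariant output error $(\hat x,u,y)\mapsto E(\hat x,u,y)$. 2. There is a full-rank invariant function $(\hat x,u)\mapsto I(\hat x,u)\in\mathbb{R}^{n+m-r}$ (a complete set of $n+m-r$ independent scalar invariants). 3. Every other invariant output error reads $$\tilde E(\hat x,u,y)=\mathcal{L}\bigl(I(\hat x,u),E(\hat x,u,y)\bigr),$$ where $\mathcal{L}$ is any smooth function such that $\mathcal{L}(I,0)=0$ and $E\mapsto\mathcal{L}(I,E)$ is invertible.
   Context: Setting. $\mathcal X\subset\mathbb{R}^n$, $\mathcal U\subset\mathbb{R}^m$, $\mathcal Y\subset\mathbb{R}^p$ are open, $p\le n$, and $f:\mathcal X\times\mathcal U\to\mathbb{R}^n$, $h:\mathcal X\times\mathcal U\to\mathcal Y$ are smooth. $G$ is a Lie group of dimension $r\le n$ with identity $e$. A (local) transformation group $(\phi_g)_{g\in G}$ on an open set $\Sigma$ is a smooth map $(g,\xi)\mapsto\phi_g(\xi)\in\Sigma$ with $\phi_e(\xi)=\xi$ and $\phi_{g_2}(\phi_{g_1}(\xi))=\phi_{g_2g_1}(\xi)$; it is local if $\phi_g(\xi)$ is defined only for $g$ near $e$ and the composition law is imposed only where it makes sense. $G$ acts by local transformation groups $\varphi_g$ on $\mathcal X$, $\psi_g$ on $\mathcal U$, and $\varrho_g$ on $\mathcal Y$. Standing assumption: for each $x$ the map $g\mapsto\varphi_g(x)$ has full rank $r$.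 Local convention: all statements are local. "For all $g$" means for all $g$ sufficiently near $e$, and "for all" points means for all generic points; all functions (such as $E$, $I$, $\mathcal L$) are only required to exist locally. Definitions. - The system $\frac{d}{dt}x=f(x,u)$ is $G$-invariant if $f(\varphi_g(x),\psi_g(u))=D\varphi_g(x)\cdot f(x,u)$ for all $g,x,u$. - The output $y=h(x,u)$ is $G$-equivariant if $h(\varphi_g(x),\psi_g(u))=\varrho_g(h(x,u))$ for all $g,x,u$. - An invariant output error is a smooth map $(\hat x,u,y)\mapsto E(\hat x,u,y)\in\mathbb{R}^p$ such that: $y\mapsto E(\hat x,u,y)$ is invertible for all $\hat x,u$; $E(\hat x,u,h(\hat x,u))=0$ for all $\hat x,u$; and $E(\varphi_g(\hat x),\psi_g(u),\varrho_g(y))=E(\hat x,u,y)$ for all $g,\hat x,u,y$. - A function $I(\hat x,u)$ is invariant if $I(\varphi_g(\hat x),\psi_g(u))=I(\hat x,u)$ for all $g,\hat x,u$; full-rank means that its Jacobian has rank $n+m-r$. It is a complete set of invariants in the sense that every invariant function of $(\hat x,u)$ is locally a function of $I$. *)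

theory Defs
  imports "HOL-Analysis.Analysis"
begin

text \<open>
  \<open>smooth_on S f\<close> (that is, \<open>f\<close> is \<open>C\<^sup>\<infinity>\<close> on \<open>S\<close>) is meant for open \<open>S\<close> only: the derivatives are
  full (not one-sided) Frechet derivatives at the points of \<open>S\<close>.
\<close>

primrec Ck_on :: "nat \<Rightarrow> 'a::euclidean_space set \<Rightarrow> ('a \<Rightarrow> 'b::real_normed_vector) \<Rightarrow> bool" where
  "Ck_on 0 S f \<longleftrightarrow> continuous_on S f"
| "Ck_on (Suc k) S f \<longleftrightarrow>
     (\<forall>x\<in>S. f differentiable (at x)) \<and> (\<forall>v. Ck_on k S (\<lambda>x. frechet_derivative f (at x) v))"

definition smooth_on :: "'a::euclidean_space set \<Rightarrow> ('a \<Rightarrow> 'b::real_normed_vector) \<Rightarrow> bool" where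
  "smooth_on S f \<longleftrightarrow> (\<forall>k. Ck_on k S f)"

text \<open>
  Invertibility in the smooth category: \<open>f\<close> has a smooth inverse on the open set \<open>f ` S\<close>.
  A smooth bijection such as \<open>y \<mapsto> y\<^sup>3\<close> does not qualify.
\<close>

definition smoothly_invertible_on ::
    "'a::euclidean_space set \<Rightarrow> ('a \<Rightarrow> 'b::euclidean_space) \<Rightarrow> bool" where
  "smoothly_invertible_on S f \<longleftrightarrow>
     smooth_on S f \<and> inj_on f S \<and> open (f ` S) \<and> smooth_on (f ` S) (inv_into S f)"


subsection \<open>Lie groups\<close>

text \<open>
  A Lie group of dimension \<open>CARD('r)\<close> is a Hausdorff, second countable topological group with a
  smooth atlas in which the group operations are smooth. The library class of topological groups
  writes arbitrary, not necessarily commutative, groups additively: the identity is \<open>0\<close>, the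
  product \<open>g h\<close> is \<open>g + h\<close>, the inverse is \<open>- g\<close>. A chart is a pair of its domain and its
  coordinate map.
\<close>

type_synonym ('g, 'r) atlas = "('g set \<times> ('g \<Rightarrow> real^'r)) set"

definition smooth_atlas :: "('g::topological_space, 'r::finite) atlas \<Rightarrow> bool" where
  "smooth_atlas \<A> \<longleftrightarrow>
     (\<Union>(U, c)\<in>\<A>. U) = UNIV \<and>
     (\<forall>(U, c)\<in>\<A>. open U \<and> open (c ` U) \<and> homeomorphism U (c ` U) c (inv_into U c)) \<and>
     (\<forall>(U, c)\<in>\<A>. \<forall>(V, d)\<in>\<A>. smooth_on (c ` (U \<inter> V)) (\<lambda>s. d (inv_into U c s)))"

definition lie_group ::
    "('g::{topological_group_add, t2_space, second_countable_topology}, 'r::finite) atlas \<Rightarrow> bool"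
  where
  "lie_group \<A> \<longleftrightarrow>
     smooth_atlas \<A> \<and>
     (\<forall>(U, c)\<in>\<A>. \<forall>(V, d)\<in>\<A>. \<forall>(W, b)\<in>\<A>.
        smooth_on {(s, t). s \<in> c ` U \<and> t \<in> d ` V \<and> inv_into U c s + inv_into V d t \<in> W}
          (\<lambda>(s, t). b (inv_into U c s + inv_into V d t))) \<and>
     (\<forall>(U, c)\<in>\<A>. \<forall>(V, d)\<in>\<A>.
        smooth_on {s. s \<in> c ` U \<and> - inv_into U c s \<in> V} (\<lambda>s. d (- inv_into U c s)))"


subsection \<open>Local transformation groups\<close>

text \<open>
  \<open>D\<close> is the set of all \<open>(g, \<xi>)\<close> for which \<open>\<phi> g \<xi>\<close> is regarded as defined; a global
  transformation group is the case \<open>D = UNIV \<times> \<Sigma>\<close>.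
\<close>

definition local_transformation_group ::
    "('g::{topological_group_add, t2_space, second_countable_topology}, 'r::finite) atlas \<Rightarrow>
     'a::euclidean_space set \<Rightarrow> ('g \<times> 'a) set \<Rightarrow> ('g \<Rightarrow> 'a \<Rightarrow> 'a) \<Rightarrow> bool" where
  "local_transformation_group \<A> \<Sigma> D \<phi> \<longleftrightarrow>
     open \<Sigma> \<and> open D \<and> {0} \<times> \<Sigma> \<subseteq> D \<and> D \<subseteq> UNIV \<times> \<Sigma> \<and>
     (\<forall>(g, \<xi>)\<in>D. \<phi> g \<xi> \<in> \<Sigma>) \<and>
     (\<forall>(U, c)\<in>\<A>. smooth_on {(t, \<xi>). t \<in> c ` U \<and> (inv_into U c t, \<xi>) \<in> D}
                    (\<lambda>(t, \<xi>). \<phi> (inv_into U c t) \<xi>)) \<and>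
     (\<forall>\<xi>\<in>\<Sigma>. \<phi> 0 \<xi> = \<xi>) \<and>
     (\<forall>g1 g2 \<xi>. (g1, \<xi>) \<in> D \<and> (g2, \<phi> g1 \<xi>) \<in> D \<and> (g2 + g1, \<xi>) \<in> D \<longrightarrow>
        \<phi> g2 (\<phi> g1 \<xi>) = \<phi> (g2 + g1) \<xi>)"

text \<open>
  The rank of \<open>g \<mapsto> \<phi> g x\<close> at \<open>g\<close> is computed in charts.
\<close>

definition full_rank_action ::
    "('g::{topological_group_add, t2_space, second_countable_topology}, 'r::finite) atlas \<Rightarrow>
     'a::euclidean_space set \<Rightarrow> ('g \<Rightarrow> 'a \<Rightarrow> 'a) \<Rightarrow> bool" where
  "full_rank_action \<A> \<Sigma> \<phi> \<longleftrightarrow>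
     (\<forall>x\<in>\<Sigma>. \<forall>\<^sub>F g in nhds 0. \<forall>(U, c)\<in>\<A>. g \<in> U \<longrightarrow>
        dim (range (frechet_derivative (\<lambda>t. \<phi> (inv_into U c t) x) (at (c g)))) = CARD('r))"


subsection \<open>Invariance and equivariance\<close>

text \<open>
  Throughout, an identity required "for all \<open>g\<close>" at the points of an open set is required locally
  uniformly: near \<open>(0, p)\<close> for every point \<open>p\<close> of the set. Then \<open>g\<close> is near the identity and all
  terms of the identity are defined.
\<close>

definition invariant_system ::
    "(real^'n) set \<Rightarrow> (real^'m) set \<Rightarrow>
     ('g::topological_group_add \<Rightarrow> real^'n \<Rightarrow> real^'n) \<Rightarrow> ('g \<Rightarrow> real^'m \<Rightarrow> real^'m) \<Rightarrow>
     ((real^'n) \<times> (real^'m) \<Rightarrow> real^'n) \<Rightarrow> bool" where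
  "invariant_system X U \<phi> \<psi> f \<longleftrightarrow>
     (\<forall>x0\<in>X. \<forall>u0\<in>U. \<forall>\<^sub>F (g, x, u) in nhds (0, x0, u0).
        f (\<phi> g x, \<psi> g u) = frechet_derivative (\<phi> g) (at x) (f (x, u)))"

definition equivariant_output ::
    "(real^'n) set \<Rightarrow> (real^'m) set \<Rightarrow>
     ('g::topological_group_add \<Rightarrow> real^'n \<Rightarrow> real^'n) \<Rightarrow> ('g \<Rightarrow> real^'m \<Rightarrow> real^'m) \<Rightarrow>
     ('g \<Rightarrow> real^'p \<Rightarrow> real^'p) \<Rightarrow> ((real^'n) \<times> (real^'m) \<Rightarrow> real^'p) \<Rightarrow> bool" where
  "equivariant_output X U \<phi> \<psi> \<rho> h \<longleftrightarrow>
     (\<forall>x0\<in>X. \<forall>u0\<in>U. \<forall>\<^sub>F (g, x, u) in nhds (0, x0, u0).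
        h (\<phi> g x, \<psi> g u) = \<rho> g (h (x, u)))"

definition invariant_function ::
    "('g::topological_group_add \<Rightarrow> real^'n \<Rightarrow> real^'n) \<Rightarrow> ('g \<Rightarrow> real^'m \<Rightarrow> real^'m) \<Rightarrow>
     ((real^'n) \<times> (real^'m)) set \<Rightarrow> ((real^'n) \<times> (real^'m) \<Rightarrow> 'b) \<Rightarrow> bool" where
  "invariant_function \<phi> \<psi> W J \<longleftrightarrow>
     (\<forall>(x0, u0)\<in>W. \<forall>\<^sub>F (g, x, u) in nhds (0, x0, u0). J (\<phi> g x, \<psi> g u) = J (x, u))"

text \<open>
  Full rank refers to the dimension \<open>CARD('k)\<close> of the codomain.
\<close>

definition full_rank_invariant ::
    "('g::topological_group_add \<Rightarrow> real^'n \<Rightarrow> real^'n) \<Rightarrow> ('g \<Rightarrow> real^'m \<Rightarrow> real^'m) \<Rightarrow>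
     ((real^'n) \<times> (real^'m)) set \<Rightarrow> ((real^'n) \<times> (real^'m) \<Rightarrow> real^'k) \<Rightarrow> bool" where
  "full_rank_invariant \<phi> \<psi> W I \<longleftrightarrow>
     smooth_on W I \<and> invariant_function \<phi> \<psi> W I \<and>
     (\<forall>z\<in>W. dim (range (frechet_derivative I (at z))) = CARD('k))"

text \<open>
  Near every point of \<open>W\<close>, every invariant function is a function of \<open>I\<close>, and a smooth one if the
  invariant function is smooth.
\<close>

definition complete_invariant ::
    "('g::topological_group_add \<Rightarrow> real^'n \<Rightarrow> real^'n) \<Rightarrow> ('g \<Rightarrow> real^'m \<Rightarrow> real^'m) \<Rightarrow>
     ((real^'n) \<times> (real^'m)) set \<Rightarrow> ((real^'n) \<times> (real^'m) \<Rightarrow> real^'k) \<Rightarrow> bool" where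
  "complete_invariant \<phi> \<psi> W I \<longleftrightarrow>
     (\<forall>W1 (J :: (real^'n) \<times> (real^'m) \<Rightarrow> real).
        open W1 \<and> W1 \<subseteq> W \<and> invariant_function \<phi> \<psi> W1 J \<longrightarrow>
        (\<forall>z0\<in>W1. \<exists>W2 A F. open W2 \<and> z0 \<in> W2 \<and> W2 \<subseteq> W1 \<and> open A \<and> I ` W2 \<subseteq> A \<and>
           (\<forall>z\<in>W2. J z = F (I z)) \<and> (smooth_on W1 J \<longrightarrow> smooth_on A F)))"


subsection \<open>Invariant output errors\<close>

text \<open>
  Local domains \<open>W \<times> V\<close> for output errors near \<open>(x0, u0, y0)\<close>. The set \<open>V\<close> contains the predicted
  outputs \<open>h (x, u)\<close> as well, so that the condition \<open>E (x, u, h (x, u)) = 0\<close> makes sense on \<open>W\<close>;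
  it need not be connected.
\<close>

definition local_domain ::
    "(real^'n) set \<Rightarrow> (real^'m) set \<Rightarrow> (real^'p) set \<Rightarrow>
     ((real^'n) \<times> (real^'m) \<Rightarrow> real^'p) \<Rightarrow> real^'n \<Rightarrow> real^'m \<Rightarrow> real^'p \<Rightarrow>
     ((real^'n) \<times> (real^'m)) set \<Rightarrow> (real^'p) set \<Rightarrow> bool" where
  "local_domain X U Y h x0 u0 y0 W V \<longleftrightarrow>
     open W \<and> (x0, u0) \<in> W \<and> W \<subseteq> X \<times> U \<and> open V \<and> y0 \<in> V \<and> V \<subseteq> Y \<and> h ` W \<subseteq> V"

definition invariant_output_error ::
    "('g::topological_group_add \<Rightarrow> real^'n \<Rightarrow> real^'n) \<Rightarrow> ('g \<Rightarrow> real^'m \<Rightarrow> real^'m) \<Rightarrow>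
     ('g \<Rightarrow> real^'p \<Rightarrow> real^'p) \<Rightarrow> ((real^'n) \<times> (real^'m) \<Rightarrow> real^'p) \<Rightarrow>
     ((real^'n) \<times> (real^'m)) set \<Rightarrow> (real^'p) set \<Rightarrow>
     ((real^'n) \<times> (real^'m) \<times> (real^'p) \<Rightarrow> real^'p) \<Rightarrow> bool" where
  "invariant_output_error \<phi> \<psi> \<rho> h W V E \<longleftrightarrow>
     smooth_on {(x, u, y). (x, u) \<in> W \<and> y \<in> V} E \<and>
     (\<forall>(x, u)\<in>W. smoothly_invertible_on V (\<lambda>y. E (x, u, y))) \<and>
     (\<forall>(x, u)\<in>W. E (x, u, h (x, u)) = 0) \<and>
     (\<forall>(x0, u0)\<in>W. \<forall>y0\<in>V. \<forall>\<^sub>F (g, x, u, y) in nhds (0, x0, u0, y0).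
        E (\<phi> g x, \<psi> g u, \<rho> g y) = E (x, u, y))"

definition error_transformation ::
    "(real^'k) set \<Rightarrow> (real^'p) set \<Rightarrow> ((real^'k) \<times> (real^'p) \<Rightarrow> real^'p) \<Rightarrow> bool" where
  "error_transformation A B L \<longleftrightarrow>
     open A \<and> open B \<and> 0 \<in> B \<and> smooth_on (A \<times> B) L \<and>
     (\<forall>i\<in>A. L (i, 0) = 0 \<and> smoothly_invertible_on B (\<lambda>\<epsilon>. L (i, \<epsilon>)))"

end

(*
  Through every point z0 = (x0, u0) the rank condition gives a flow box: a slice z0 + S k transversal
  to the orbit of z0 is moved by the group elements near the identity, and (g, k) are coordinates
  near z0 in which the action only translates g. So k is a full-rank invariant, and any invariant
  function depends on k alone. A full-rank invariant I therefore parametrizes the slice by the inverse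
  function theorem, which makes it complete. The group coordinate serves as a moving frame: the
  difference of y and h z after transport to the slice is an invariant output error. Finally, an
  invariant output error is determined by its restriction to the slice, where E' is a function of I
  and of the invertible E.
*)

theory Submission
  imports Defs
begin

section \<open>Smooth functions\<close>

text \<open>The action is only local:
  \<open>\<tau> g2 (\<tau> g1 \<xi>) = \<tau> (g2 + g1) \<xi>\<close> may be used only when all
  three terms are defined. Hence nearly every identity is an \<open>eventually\<close> statement,
  and its domain conditions hold because the relevant terms converge to points of open sets. The
  group is not assumed commutative and is seen in coordinates through one chart around the identity;
  products are handled by continuity, while smoothness of the moving frame rests on smoothness of
  inversion. Since \<open>smooth_on\<close> asks for derivatives of every order, a merely continuous
  or once differentiable local inverse is not enough. The inverse is raised in order by treating its
  derivative as the solution of a linear equation whose operator depends on a parameter. A local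
  domain must contain the predicted output \<open>h z0\<close> besides the arbitrary output
  \<open>y0\<close>, and the two may be far apart. So arguments near \<open>(z0, y0)\<close> are
  repeated near \<open>(z0, h z0)\<close> and the two output neighbourhoods are united; this also
  puts 0 into the domain of \<open>L\<close>.\<close>

lemma Ck_on_imp_continuous_on: "Ck_on k S f \<Longrightarrow> continuous_on S f"
  by (metis Ck_on.simps differentiable_at_imp_differentiable_on differentiable_imp_continuous_on
      not0_implies_Suc)

lemma Ck_on_SucD: "Ck_on (Suc k) S f \<Longrightarrow> Ck_on k S f"
proof (induction k arbitrary: f)
  case 0
  then show ?case using Ck_on_imp_continuous_on[OF 0] by simp
next
  case (Suc k)
  show ?case
    unfolding Ck_on.simps(2)[of k]
  proof (intro conjI allI)
    show "\<forall>x\<in>S. f differentiable at x"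
      using Suc.prems by simp
    show "Ck_on k S (\<lambda>x. frechet_derivative f (at x) v)" for v
      by (rule Suc.IH) (use Suc.prems in simp)
  qed
qed

lemma Ck_on_subset: "Ck_on k S f \<Longrightarrow> T \<subseteq> S \<Longrightarrow> Ck_on k T f"
  by (induction k arbitrary: f) (auto intro: continuous_on_subset)

text \<open>\<open>frechet_derivative\<close> at a point sees a whole neighbourhood, so agreement on
  \<open>S\<close> passes to all derivatives because \<open>S\<close> is open.\<close>

lemma Ck_on_cong:
  assumes "open S" "\<And>x. x \<in> S \<Longrightarrow> f x = g x" "Ck_on k S f"
  shows "Ck_on k S g"
  using assms(2,3)
proof (induction k arbitrary: f g)
  case 0
  then show ?case by (metis Ck_on.simps(1) continuous_on_cong)
next
  case (Suc k)
  have d: "(g has_derivative frechet_derivative f (at x)) (at x)" if "x \<in> S" for x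
    by (rule has_derivative_transform_within_open[OF _ assms(1) that, of f])
      (use Suc.prems that in \<open>auto simp: frechet_derivative_works\<close>)
  have "Ck_on k S (\<lambda>x. frechet_derivative g (at x) v)" for v
  proof (rule Suc.IH)
    show "frechet_derivative f (at x) v = frechet_derivative g (at x) v" if "x \<in> S" for x
      using frechet_derivative_at[OF d[OF that]] by simp
    show "Ck_on k S (\<lambda>x. frechet_derivative f (at x) v)"
      using Suc.prems by simp
  qed
  with d show ?case by (auto simp: differentiable_def)
qed

text \<open>Frees the inductions on the order from the choice operator behind
  \<open>frechet_derivative\<close>: any explicitly known derivative may serve.\<close>

lemma Ck_on_SucI:
  assumes "open S" "\<And>x. x \<in> S \<Longrightarrow> (f has_derivative f' x) (at x)"
    and "\<And>v. Ck_on k S (\<lambda>x. f' x v)"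
  shows "Ck_on (Suc k) S f"
proof -
  have "Ck_on k S (\<lambda>x. frechet_derivative f (at x) v)" for v
    by (rule Ck_on_cong[OF assms(1) _ assms(3)[of v]])
      (use frechet_derivative_at[OF assms(2)] in auto)
  then show ?thesis
    using assms(2) by (auto simp: differentiable_def)
qed

lemma Ck_on_Suc_derivative:
  assumes "Ck_on (Suc k) S f" "x \<in> S"
  shows "(f has_derivative frechet_derivative f (at x)) (at x)"
  using assms by (auto simp: frechet_derivative_works)

lemma Ck_on_const: "open S \<Longrightarrow> Ck_on k S (\<lambda>x. c)"
  by (induction k arbitrary: c) (auto intro: Ck_on_cong)

lemma Ck_on_bounded_linear:
  assumes "open S" "bounded_linear L" "Ck_on k S f"
  shows "Ck_on k S (\<lambda>x. L (f x))"
  using assms(3)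
proof (induction k arbitrary: f)
  case 0
  then show ?case
    by (auto intro!: bounded_linear.continuous_on[OF assms(2)])
next
  case (Suc k)
  show ?case
  proof (rule Ck_on_SucI[OF assms(1)])
    show "((\<lambda>x. L (f x)) has_derivative (\<lambda>v. L (frechet_derivative f (at x) v))) (at x)"
      if "x \<in> S" for x
      by (rule bounded_linear.has_derivative[OF assms(2) Ck_on_Suc_derivative[OF Suc.prems that]])
    show "Ck_on k S (\<lambda>x. L (frechet_derivative f (at x) v))" for v
      by (rule Suc.IH) (use Suc.prems in simp)
  qed
qed

lemma Ck_on_ident: "open S \<Longrightarrow> Ck_on k S (\<lambda>x. x)"
  by (cases k) (auto intro!: Ck_on_SucI Ck_on_const has_derivative_ident)

lemma Ck_on_add:
  assumes "open S" "Ck_on k S f" "Ck_on k S g"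
  shows "Ck_on k S (\<lambda>x. f x + g x)"
  using assms(2,3)
proof (induction k arbitrary: f g)
  case 0
  then show ?case by (auto intro: continuous_on_add)
next
  case (Suc k)
  show ?case
  proof (rule Ck_on_SucI[OF assms(1)])
    show "((\<lambda>x. f x + g x) has_derivative
        (\<lambda>v. frechet_derivative f (at x) v + frechet_derivative g (at x) v)) (at x)"
      if "x \<in> S" for x
      using Suc.prems that by (intro has_derivative_add Ck_on_Suc_derivative)
    show "Ck_on k S (\<lambda>x. frechet_derivative f (at x) v + frechet_derivative g (at x) v)" for v
      by (rule Suc.IH) (use Suc.prems in simp_all)
  qed
qed

lemma Ck_on_sum:
  assumes "open S" "\<And>i. i \<in> A \<Longrightarrow> Ck_on k S (f i)"
  shows "Ck_on k S (\<lambda>x. \<Sum>i\<in>A. f i x)"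
  using assms(2)
  by (induction A rule: infinite_finite_induct)
    (auto intro: Ck_on_const[OF assms(1)] Ck_on_add[OF assms(1)])

lemma Ck_on_scaleR:
  fixes f :: "'a::euclidean_space \<Rightarrow> real" and g :: "'a \<Rightarrow> 'b::real_normed_vector"
  assumes "open S" "Ck_on k S f" "Ck_on k S g"
  shows "Ck_on k S (\<lambda>x. f x *\<^sub>R g x)"
  using assms(2,3)
proof (induction k arbitrary: f g)
  case 0
  then show ?case by (auto intro: continuous_on_scaleR)
next
  case (Suc k)
  \<comment> \<open>The product rule pairs a derivative with an undifferentiated factor, so the
    factors themselves are lowered to order \<open>k\<close>.\<close>
  note Ck_on_SucD[OF Suc.prems(1)] Ck_on_SucD[OF Suc.prems(2)]
  moreover have "Ck_on k S (\<lambda>x. frechet_derivative f (at x) v)"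
    "Ck_on k S (\<lambda>x. frechet_derivative g (at x) v)" for v
    using Suc.prems by simp_all
  ultimately have "Ck_on k S (\<lambda>x. f x *\<^sub>R frechet_derivative g (at x) v +
      frechet_derivative f (at x) v *\<^sub>R g x)" for v
    by (intro Ck_on_add[OF assms(1)] Suc.IH)
  then show ?case
    by (intro Ck_on_SucI[OF assms(1) has_derivative_scaleR])
      (use Suc.prems in \<open>auto intro: Ck_on_Suc_derivative\<close>)
qed

lemma linear_expand_basis:
  fixes L :: "'a::euclidean_space \<Rightarrow> 'b::real_vector"
  assumes "linear L"
  shows "L x = (\<Sum>b\<in>Basis. (x \<bullet> b) *\<^sub>R L b)"
proof -
  have "L x = L (\<Sum>b\<in>Basis. (x \<bullet> b) *\<^sub>R b)"
    by (simp add: euclidean_representation)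
  also have "\<dots> = (\<Sum>b\<in>Basis. (x \<bullet> b) *\<^sub>R L b)"
    using assms by (simp add: linear_sum linear_scale)
  finally show ?thesis .
qed

text \<open>An operator-valued map is handled through the vectors \<open>A x b\<close> for fixed
  \<open>b\<close>: expanding \<open>w x\<close> in the basis turns the application into a finite
  sum of products. The derivative given by the chain rule has this shape.\<close>

lemma Ck_on_apply_linear:
  fixes A :: "'a::euclidean_space \<Rightarrow> 'b::euclidean_space \<Rightarrow> 'c::real_normed_vector"
  assumes "open S" "\<And>x. x \<in> S \<Longrightarrow> linear (A x)"
    and "\<And>b. Ck_on k S (\<lambda>x. A x b)" "Ck_on k S w"
  shows "Ck_on k S (\<lambda>x. A x (w x))"
proof -
  have "Ck_on k S (\<lambda>x. \<Sum>b\<in>Basis. (w x \<bullet> b) *\<^sub>R A x b)"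
    using assms by (intro Ck_on_sum Ck_on_scaleR Ck_on_bounded_linear[OF _ bounded_linear_inner_left])
  then show ?thesis
    by (rule Ck_on_cong[OF assms(1), rotated]) (use linear_expand_basis[OF assms(2)] in metis)
qed

lemma Ck_on_compose:
  fixes f :: "'a::euclidean_space \<Rightarrow> 'b::euclidean_space" and g :: "'b \<Rightarrow> 'c::real_normed_vector"
  assumes "open S" "open T" "f ` S \<subseteq> T" "Ck_on k S f" "Ck_on k T g"
  shows "Ck_on k S (\<lambda>x. g (f x))"
  using assms(4,5)
proof (induction k arbitrary: g)
  case 0
  then show ?case
    using assms(3) by (auto intro: continuous_on_compose2)
next
  case (Suc k)
  have f: "(f has_derivative frechet_derivative f (at x)) (at x)"
    and g: "(g has_derivative frechet_derivative g (at (f x))) (at (f x))" if "x \<in> S" for x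
    using that assms(3) Suc.prems by (auto intro!: Ck_on_Suc_derivative)
  show ?case
  proof (rule Ck_on_SucI[OF assms(1)])
    show "((\<lambda>x. g (f x)) has_derivative
        (\<lambda>v. frechet_derivative g (at (f x)) (frechet_derivative f (at x) v))) (at x)"
      if "x \<in> S" for x
      using diff_chain_at[OF f[OF that] g[OF that]] by (simp add: o_def)
    show "Ck_on k S (\<lambda>x. frechet_derivative g (at (f x)) (frechet_derivative f (at x) v))" for v
    proof (rule Ck_on_apply_linear[OF assms(1)])
      show "linear (frechet_derivative g (at (f x)))" if "x \<in> S" for x
        using g[OF that] by (rule has_derivative_linear)
      show "Ck_on k S (\<lambda>x. frechet_derivative g (at (f x)) b)" for b
        by (rule Suc.IH) (use Suc.prems Ck_on_SucD in auto)
      show "Ck_on k S (\<lambda>x. frechet_derivative f (at x) v)"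
        using Suc.prems by simp
    qed
  qed
qed

lemma smooth_on_imp_continuous_on: "smooth_on S f \<Longrightarrow> continuous_on S f"
  unfolding smooth_on_def using Ck_on_imp_continuous_on by blast

lemma smooth_on_subset: "smooth_on S f \<Longrightarrow> T \<subseteq> S \<Longrightarrow> smooth_on T f"
  unfolding smooth_on_def using Ck_on_subset by blast

lemma smooth_on_cong:
  "open S \<Longrightarrow> (\<And>x. x \<in> S \<Longrightarrow> f x = g x) \<Longrightarrow> smooth_on S f \<Longrightarrow> smooth_on S g"
  unfolding smooth_on_def using Ck_on_cong by blast

lemma smooth_on_const: "open S \<Longrightarrow> smooth_on S (\<lambda>x. c)"
  unfolding smooth_on_def using Ck_on_const by blast

lemma smooth_on_ident: "open S \<Longrightarrow> smooth_on S (\<lambda>x. x)"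
  unfolding smooth_on_def using Ck_on_ident by blast

lemma smooth_on_bounded_linear:
  "open S \<Longrightarrow> bounded_linear L \<Longrightarrow> smooth_on S f \<Longrightarrow> smooth_on S (\<lambda>x. L (f x))"
  unfolding smooth_on_def using Ck_on_bounded_linear by blast

lemma smooth_on_add:
  "open S \<Longrightarrow> smooth_on S f \<Longrightarrow> smooth_on S g \<Longrightarrow> smooth_on S (\<lambda>x. f x + g x)"
  unfolding smooth_on_def using Ck_on_add by blast

lemma smooth_on_diff:
  "open S \<Longrightarrow> smooth_on S f \<Longrightarrow> smooth_on S g \<Longrightarrow> smooth_on S (\<lambda>x. f x - g x)"
  using smooth_on_add[of S f "\<lambda>x. - g x"]
    smooth_on_bounded_linear[OF _ bounded_linear_minus[OF bounded_linear_ident], of S g]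
  by simp

lemma smooth_on_compose:
  fixes f :: "'a::euclidean_space \<Rightarrow> 'b::euclidean_space"
  shows "open S \<Longrightarrow> open T \<Longrightarrow> f ` S \<subseteq> T \<Longrightarrow> smooth_on S f \<Longrightarrow> smooth_on T g \<Longrightarrow>
    smooth_on S (\<lambda>x. g (f x))"
  unfolding smooth_on_def using Ck_on_compose by blast

lemma bounded_linear_Pair_zero:
  "bounded_linear (\<lambda>x. (x, 0))" "bounded_linear (\<lambda>y. (0, y))"
  by (intro bounded_linear_Pair bounded_linear_ident bounded_linear_zero)+

lemma smooth_on_Pair:
  assumes "open S" "smooth_on S f" "smooth_on S g"
  shows "smooth_on S (\<lambda>x. (f x, g x))"
  using smooth_on_add[OF assms(1)
      smooth_on_bounded_linear[OF assms(1) bounded_linear_Pair_zero(1) assms(2)]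
      smooth_on_bounded_linear[OF assms(1) bounded_linear_Pair_zero(2) assms(3)]]
  by simp

lemma smooth_on_fst: "open S \<Longrightarrow> smooth_on S f \<Longrightarrow> smooth_on S (\<lambda>x. fst (f x))"
  by (rule smooth_on_bounded_linear[OF _ bounded_linear_fst])

lemma smooth_on_snd: "open S \<Longrightarrow> smooth_on S f \<Longrightarrow> smooth_on S (\<lambda>x. snd (f x))"
  by (rule smooth_on_bounded_linear[OF _ bounded_linear_snd])

lemma smooth_on_has_derivative:
  "smooth_on S f \<Longrightarrow> x \<in> S \<Longrightarrow> (f has_derivative frechet_derivative f (at x)) (at x)"
  unfolding smooth_on_def using Ck_on_Suc_derivative by blast

lemma smooth_on_derivative:
  "smooth_on S f \<Longrightarrow> smooth_on S (\<lambda>x. frechet_derivative f (at x) v)"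
  unfolding smooth_on_def by (metis Ck_on.simps(2))

section \<open>Smooth inverses\<close>

text \<open>Injectivity is stable with a uniform constant: a small change on the basis is a small
  change in operator norm, and it costs at most half of the lower bound at \<open>x\<close>.\<close>

lemma eventually_bounded_below_linear:
  fixes A :: "'a::euclidean_space \<Rightarrow> 'b::euclidean_space \<Rightarrow> 'c::euclidean_space"
  assumes "\<forall>\<^sub>F y in nhds x. linear (A y)" "inj (A x)"
    and "\<And>b. continuous (at x) (\<lambda>y. A y b)"
  obtains c where "c > 0" "\<forall>\<^sub>F y in nhds x. \<forall>v. c * norm v \<le> norm (A y v)"
proof -
  have lin: "linear (A x)"
    using assms(1) by (rule eventually_nhds_x_imp_x)
  then obtain B where B: "B > 0" "\<And>v. B * norm v \<le> norm (A x v)"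
    using linear_inj_bounded_below_pos assms(2) by blast
  \<comment> \<open>Each of the \<open>DIM('b)\<close> basis vectors contributes at most
    \<open>norm v * e\<close>, together \<open>B / 2 * norm v\<close>.\<close>
  define e where "e = B / (2 * DIM('b))"
  have "e > 0"
    using B by (simp add: e_def)
  have "\<forall>\<^sub>F y in nhds x. \<forall>b\<in>Basis. norm (A y b - A x b) < e"
    unfolding eventually_ball_finite_distrib[OF finite_Basis]
  proof
    fix b
    have "((\<lambda>y. A y b) \<longlongrightarrow> A x b) (nhds x)"
      using assms(3)[of b] tendsto_at_iff_tendsto_nhds[of "\<lambda>y. A y b" x]
      by (simp add: continuous_at)
    from tendstoD[OF this \<open>e > 0\<close>] show "\<forall>\<^sub>F y in nhds x. norm (A y b - A x b) < e"
      by (simp add: dist_norm)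
  qed
  then have "\<forall>\<^sub>F y in nhds x. \<forall>v. B / 2 * norm v \<le> norm (A y v)"
    using assms(1)
  proof eventually_elim
    case (elim y)
    show ?case
    proof
      fix v
      have "A x v - A y v = (\<Sum>b\<in>Basis. (v \<bullet> b) *\<^sub>R (A x b - A y b))"
        using linear_expand_basis[OF lin, of v] linear_expand_basis[OF elim(2), of v]
        by (simp add: scaleR_diff_right sum_subtractf)
      also have "norm \<dots> \<le> (\<Sum>b\<in>(Basis::'b set). norm v * e)"
      proof (rule sum_norm_le)
        fix b :: 'b assume b: "b \<in> Basis"
        have "norm (A x b - A y b) \<le> e"
          using elim(1) b by (metis less_imp_le norm_minus_commute)
        then show "norm ((v \<bullet> b) *\<^sub>R (A x b - A y b)) \<le> norm v * e"
          using Basis_le_norm[OF b, of v] by (auto intro!: mult_mono)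
      qed
      also have "\<dots> = B / 2 * norm v"
        by (simp add: e_def)
      finally have "norm (A x v) - norm (A y v) \<le> B / 2 * norm v"
        using norm_triangle_ineq2[of "A x v" "A y v"] by linarith
      then show "B / 2 * norm v \<le> norm (A y v)"
        using B(2)[of v] by linarith
    qed
  qed
  with B(1) show thesis
    by (intro that[of "B / 2"]) auto
qed

text \<open>Nothing is presupposed about \<open>w\<close>. The lower bound controls
  \<open>w y - w x\<close> by \<open>A y (w y - w x) = v - A y (w x)\<close>, which tends to
  \<open>v - A x (w x) = 0\<close>.\<close>

lemma continuous_at_linear_solution:
  fixes A :: "'a::euclidean_space \<Rightarrow> 'b::euclidean_space \<Rightarrow> 'c::euclidean_space"
  assumes "\<forall>\<^sub>F y in nhds x. linear (A y)" "inj (A x)"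
    and "\<And>b. continuous (at x) (\<lambda>y. A y b)"
    and "\<forall>\<^sub>F y in nhds x. A y (w y) = v"
  shows "continuous (at x) w"
proof -
  obtain c where c: "c > 0" "\<forall>\<^sub>F y in nhds x. \<forall>v. c * norm v \<le> norm (A y v)"
    by (rule eventually_bounded_below_linear[OF assms(1-3)])
  have x: "A x (w x) = v"
    using assms(4) by (rule eventually_nhds_x_imp_x)
  have "((\<lambda>y. A y (w x)) \<longlongrightarrow> A x (w x)) (nhds x)"
    using assms(3)[of "w x"] tendsto_at_iff_tendsto_nhds[of "\<lambda>y. A y (w x)" x]
    by (simp add: continuous_at)
  then have *: "((\<lambda>y. norm (v - A y (w x)) / c) \<longlongrightarrow> 0) (nhds x)"
    using x c(1) by (auto intro!: tendsto_eq_intros)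
  have le: "\<forall>\<^sub>F y in nhds x. norm (w y - w x) \<le> norm (v - A y (w x)) / c"
    using assms(1) c(2) assms(4)
  proof eventually_elim
    case (elim y)
    have "c * norm (w y - w x) \<le> norm (A y (w y - w x))"
      using elim(2) by blast
    also have "A y (w y - w x) = v - A y (w x)"
      using elim(1,3) by (simp add: linear_diff)
    finally show ?case
      using c(1) by (simp add: field_simps)
  qed
  have "((\<lambda>y. w y - w x) \<longlongrightarrow> 0) (nhds x)"
    by (rule Lim_null_comparison[OF le *])
  then have "(w \<longlongrightarrow> w x) (nhds x)"
    by (simp add: LIM_zero_iff)
  then show ?thesis
    by (simp add: continuous_at tendsto_at_iff_tendsto_nhds)
qed

text \<open>
  Differentiating \<open>A y (w y) = v\<close> expresses the derivative of \<open>w\<close> by \<open>A\<^sup>-\<^sup>1\<close> again, so that the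
  order of differentiability of \<open>w\<close> can be raised by induction.
\<close>

lemma has_derivative_linear_solution:
  fixes A :: "'a::euclidean_space \<Rightarrow> 'b::euclidean_space \<Rightarrow> 'c::euclidean_space"
  assumes "\<forall>\<^sub>F y in nhds x. linear (A y)"
    and "\<And>b. ((\<lambda>y. A y b) has_derivative A' b) (at x)"
    and "bounded_linear R" "\<And>b. R (A x b) = b"
    and "\<forall>\<^sub>F y in nhds x. A y (w y) = v"
  shows "(w has_derivative (\<lambda>h. - R (A' (w x) h))) (at x)"
proof -
  have cont: "continuous (at x) (\<lambda>y. A y b)" for b
    using assms(2) by (rule has_derivative_continuous)
  have lin: "linear (A x)"
    using assms(1) by (rule eventually_nhds_x_imp_x)
  have x: "A x (w x) = v"
    using assms(5) by (rule eventually_nhds_x_imp_x)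
  have "inj (A x)"
    by (metis assms(4) injI)
  then have w: "continuous (at x) w"
    by (rule continuous_at_linear_solution[OF assms(1) _ cont assms(5)])
  interpret R: bounded_linear R by fact
  \<comment> \<open>Applying \<open>R\<close> to \<open>A y (w y) = v\<close> yields
    \<open>w y - w x = R v - r y - q y\<close>. In \<open>r\<close> the unknown is frozen at
    \<open>w x\<close>, so it is differentiable; \<open>q\<close> is the remainder of second
    order.\<close>
  define q where "q y = R (\<Sum>b\<in>Basis. ((w y - w x) \<bullet> b) *\<^sub>R (A y b - A x b))" for y
  define r where "r y = R (A y (w x))" for y
  have r: "(r has_derivative (\<lambda>h. R (A' (w x) h))) (at x)"
    unfolding r_def by (rule R.has_derivative[OF assms(2)])
  text \<open>\<open>R\<close> applied to \<open>(A y - A x) (w y - w x)\<close> is a product of a null function and a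
    differentiable null function.\<close>
  have prod: "((\<lambda>y. ((w y - w x) \<bullet> b) *\<^sub>R (A y b - A x b)) has_derivative (\<lambda>h. 0)) (at x)" for b
  proof -
    have d: "((\<lambda>y. A y b - A x b) has_derivative A' b) (at x)"
      using assms(2)[of b] by (auto intro!: derivative_eq_intros)
    obtain K where K: "K > 0" "\<And>h. norm (A' b h) \<le> norm h * K"
      using bounded_linear.pos_bounded[OF has_derivative_bounded_linear[OF assms(2)[of b]]] by blast
    show ?thesis
      unfolding has_derivative_at2
    proof (intro conjI)
      show "bounded_linear (\<lambda>h::'a. 0::'c)" by (rule bounded_linear_zero)
      let ?s = "\<lambda>y. (w y - w x) \<bullet> b"
      let ?e = "\<lambda>y. (1 / norm (y - x)) *\<^sub>R (A y b - A x b - A' b (y - x))"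
      have e: "(?e \<longlongrightarrow> 0) (at x)"
        using assms(2)[of b] by (simp add: has_derivative_at2 diff_diff_eq)
      have s: "(?s \<longlongrightarrow> 0) (at x)"
        using w by (auto simp: continuous_at intro!: tendsto_eq_intros)
      have "((\<lambda>y. \<bar>?s y\<bar> * (norm (?e y) + K)) \<longlongrightarrow> 0) (at x)"
        using tendsto_mult[OF tendsto_rabs[OF s] tendsto_add[OF tendsto_norm[OF e] tendsto_const[of K]]]
        by simp
      moreover have "\<forall>\<^sub>F y in at x. norm ((1 / norm (y - x)) *\<^sub>R (?s y *\<^sub>R (A y b - A x b) -
          (?s x *\<^sub>R (A x b - A x b) + 0))) \<le> \<bar>?s y\<bar> * (norm (?e y) + K)"
        unfolding eventually_at_filter
      proof (rule always_eventually, intro allI impI)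
        fix y assume "y \<noteq> x"
        then have n: "norm (y - x) > 0" by simp
        have "(1 / norm (y - x)) *\<^sub>R (A y b - A x b) = ?e y + (1 / norm (y - x)) *\<^sub>R A' b (y - x)"
          by (simp add: algebra_simps)
        also have "norm \<dots> \<le> norm (?e y) + norm ((1 / norm (y - x)) *\<^sub>R A' b (y - x))"
          by (rule norm_triangle_ineq)
        also have "norm ((1 / norm (y - x)) *\<^sub>R A' b (y - x)) \<le> K"
          using K(2)[of "y - x"] n by (simp add: field_simps)
        finally have "norm ((1 / norm (y - x)) *\<^sub>R (A y b - A x b)) \<le> norm (?e y) + K"
          by simp
        from mult_left_mono[OF this, of "\<bar>?s y\<bar>"]
        show "norm ((1 / norm (y - x)) *\<^sub>R (?s y *\<^sub>R (A y b - A x b) -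
          (?s x *\<^sub>R (A x b - A x b) + 0))) \<le> \<bar>?s y\<bar> * (norm (?e y) + K)"
          by (simp add: mult_ac)
      qed
      ultimately show "(\<lambda>y. (1 / norm (y - x)) *\<^sub>R (?s y *\<^sub>R (A y b - A x b) -
          (?s x *\<^sub>R (A x b - A x b) + 0))) \<midarrow>x\<rightarrow> 0"
        by (rule Lim_null_comparison[rotated])
    qed
  qed
  have "(q has_derivative (\<lambda>h. R (\<Sum>b\<in>(Basis::'b set). 0))) (at x)"
    unfolding q_def by (intro R.has_derivative has_derivative_sum prod)
  then have q: "(q has_derivative (\<lambda>h. 0)) (at x)"
    by simp
  have ev: "\<forall>\<^sub>F y in nhds x. w x + R v - r y - q y = w y"
    using assms(1,5)
  proof eventually_elim
    case (elim y)
    have "(\<Sum>b\<in>Basis. ((w y - w x) \<bullet> b) *\<^sub>R (A y b - A x b)) = A y (w y - w x) - A x (w y - w x)"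
      using linear_expand_basis[OF lin, of "w y - w x"] linear_expand_basis[OF elim(1), of "w y - w x"]
      by (simp add: scaleR_diff_right sum_subtractf)
    also have "\<dots> = v - A y (w x) - A x (w y - w x)"
      using elim by (simp add: linear_diff)
    finally have "q y = R v - r y - (w y - w x)"
      using assms(4) by (simp add: q_def r_def R.diff)
    then show ?case by simp
  qed
  have "\<forall>\<^sub>F y in at x. w x + R v - r y - q y = w y"
    using eventually_mono[OF ev] by (simp add: eventually_at_filter)
  moreover have "w x + R v - r x - q x = w x"
    by (rule eventually_nhds_x_imp_x[OF ev])
  moreover have "((\<lambda>y. w x + R v - r y - q y) has_derivative (\<lambda>h. 0 - R (A' (w x) h) - 0)) (at x)"
    by (intro has_derivative_diff has_derivative_const r q)
  ultimately have "(w has_derivative (\<lambda>h. 0 - R (A' (w x) h) - 0)) (at x)"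
    using has_derivative_transform_eventually[of "\<lambda>y. w x + R v - r y - q y" _ x UNIV w] by blast
  then show ?thesis by simp
qed

text \<open>Inverting the operators keeps the order of differentiability. The derivative of
  \<open>R x v\<close> in direction \<open>h\<close> is \<open>- R x\<close> applied to the
  \<open>h\<close>-derivative of \<open>A\<close> at the vector \<open>R x v\<close>. It involves
  \<open>R\<close> only undifferentiated, so the induction hypothesis for all \<open>v\<close>
  covers it.\<close>

lemma Ck_on_linear_solution:
  fixes A :: "'a::euclidean_space \<Rightarrow> 'b::euclidean_space \<Rightarrow> 'c::euclidean_space"
  assumes "open S" "\<And>x. x \<in> S \<Longrightarrow> linear (A x)"
    and "\<And>x. x \<in> S \<Longrightarrow> linear (R x)" "\<And>x b. x \<in> S \<Longrightarrow> R x (A x b) = b"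
    and "\<And>x v. x \<in> S \<Longrightarrow> A x (R x v) = v"
    and "\<And>b. Ck_on k S (\<lambda>x. A x b)"
  shows "Ck_on k S (\<lambda>x. R x v)"
  using assms(6)
proof (induction k arbitrary: v)
  case 0
  have "continuous (at x) (\<lambda>x. R x v)" if "x \<in> S" for x
  proof (rule continuous_at_linear_solution)
    show "\<forall>\<^sub>F y in nhds x. linear (A y)" "\<forall>\<^sub>F y in nhds x. A y (R y v) = v"
      using assms(1,2,5) that by (auto simp: eventually_nhds)
    show "inj (A x)"
      by (metis assms(4) injI that)
    show "continuous (at x) (\<lambda>y. A y b)" for b
      using 0 assms(1) that by (simp add: continuous_on_eq_continuous_at)
  qed
  then show ?case by (simp add: continuous_at_imp_continuous_on)
next
  case (Suc k)
  have A: "((\<lambda>y. A y b) has_derivative frechet_derivative (\<lambda>y. A y b) (at x)) (at x)"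
    if "x \<in> S" for x b
    using Suc.prems that by (rule Ck_on_Suc_derivative)
  have R: "Ck_on k S (\<lambda>x. R x v)" for v
    by (rule Suc.IH) (rule Ck_on_SucD[OF Suc.prems])
  show ?case
  proof (rule Ck_on_SucI[OF assms(1)])
    fix x assume x: "x \<in> S"
    show "((\<lambda>x. R x v) has_derivative
        (\<lambda>h. - R x (frechet_derivative (\<lambda>y. A y (R x v)) (at x) h))) (at x)"
    proof (rule has_derivative_linear_solution[where A = A and w = "\<lambda>x. R x v" and v = v])
      show "\<forall>\<^sub>F y in nhds x. linear (A y)" "\<forall>\<^sub>F y in nhds x. A y (R y v) = v"
        using assms(1,2,5) x by (auto simp: eventually_nhds)
    qed (use A x assms in \<open>auto simp: linear_conv_bounded_linear\<close>)
  next
    fix h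
    let ?D = "\<lambda>x b. frechet_derivative (\<lambda>y. A y b) (at x) h"
    \<comment> \<open>The linearity is in \<open>b\<close>, while the differentiation is in the
      parameter: it is inherited from \<open>A y\<close> for \<open>y\<close> near \<open>x\<close>
      by uniqueness of derivatives.\<close>
    have lin: "linear (?D x)" if x: "x \<in> S" for x
    proof -
      have *: "((\<lambda>y. A y (b + c)) has_derivative (\<lambda>h. frechet_derivative (\<lambda>y. A y b) (at x) h +
          frechet_derivative (\<lambda>y. A y c) (at x) h)) (at x)" for b c
        by (rule has_derivative_transform_within_open[OF has_derivative_add[OF A A] assms(1) x])
          (use x assms(2) in \<open>auto simp: linear_add\<close>)
      have **: "((\<lambda>y. A y (r *\<^sub>R b)) has_derivative (\<lambda>h. r *\<^sub>R frechet_derivative (\<lambda>y. A y b) (at x) h))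
          (at x)" for b r
        by (rule has_derivative_transform_within_open[OF has_derivative_scaleR_right[OF A] assms(1) x])
          (use x assms(2) in \<open>auto simp: linear_scale\<close>)
      show ?thesis
      proof (rule linearI)
        show "?D x (b + c) = ?D x b + ?D x c" for b c
          by (rule fun_cong[OF frechet_derivative_at[OF *], symmetric])
        show "?D x (r *\<^sub>R b) = r *\<^sub>R ?D x b" for r b
          by (rule fun_cong[OF frechet_derivative_at[OF **], symmetric])
      qed
    qed
    have w': "Ck_on k S (\<lambda>x. ?D x (R x v))"
      by (rule Ck_on_apply_linear[OF assms(1) lin _ R]) (use Suc.prems in auto)
    have "Ck_on k S (\<lambda>x. R x (?D x (R x v)))"
      by (rule Ck_on_apply_linear[where A = R, OF assms(1,3) R w'])
    then show "Ck_on k S (\<lambda>x. - R x (?D x (R x v)))"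
      by (rule Ck_on_bounded_linear[OF assms(1) bounded_linear_minus[OF bounded_linear_ident]])
  qed
qed

section \<open>The inverse function theorem in the smooth category\<close>

lemma injective_image_open_homeomorphic:
  fixes f :: "'a::euclidean_space \<Rightarrow> 'b::euclidean_space"
  assumes "open S" "continuous_on S f" "inj_on f S" "DIM('a) = DIM('b)"
  shows "open (f ` S)" "continuous_on (f ` S) (inv_into S f)"
proof -
  show op: "open (f ` S)"
    using assms by (intro invariance_of_domain_gen) auto
  \<comment> \<open>Invariance of domain is applied to every open \<open>T\<close> inside
    \<open>S\<close>: thus \<open>f\<close> is an open map onto its image, which is continuity of
    the inverse.\<close>
  have "openin (top_of_set (f ` S)) (f ` T)" if "openin (top_of_set S) T" for T
  proof -
    have "open T" "T \<subseteq> S"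
      using that assms(1) openin_open_eq by auto
    then have "open (f ` T)"
      using invariance_of_domain_gen[OF \<open>open T\<close> continuous_on_subset[OF assms(2)]
          inj_on_subset[OF assms(3)]] assms(4) by simp
    then show ?thesis
      using op \<open>T \<subseteq> S\<close> by (simp add: image_mono openin_open_eq)
  qed
  then show "continuous_on (f ` S) (inv_into S f)"
    by (intro continuous_on_inverse_open_map[OF assms(2)]) (use assms(3) in auto)
qed

text \<open>A bootstrap: the derivative \<open>R y\<close> of the inverse \<open>?g\<close> is the
  inverse of \<open>?D (?g y)\<close>. If \<open>?g\<close> has order \<open>k\<close>, then so has
  \<open>?D (?g y) b\<close>, hence \<open>R y v\<close>, and \<open>?g\<close> has order
  \<open>k + 1\<close>.\<close>

lemma smoothly_invertible_onI:
  fixes f :: "'a::euclidean_space \<Rightarrow> 'b::euclidean_space"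
  assumes "open S" "smooth_on S f" "inj_on f S" "DIM('a) = DIM('b)"
    and inj: "\<And>x. x \<in> S \<Longrightarrow> inj (frechet_derivative f (at x))"
  shows "smoothly_invertible_on S f"
proof -
  let ?g = "inv_into S f" and ?D = "\<lambda>x. frechet_derivative f (at x)"
  have opn: "open (f ` S)" and cont: "continuous_on (f ` S) ?g"
    using injective_image_open_homeomorphic[OF assms(1) _ assms(3,4)]
      smooth_on_imp_continuous_on[OF assms(2)] by auto
  have gS: "?g y \<in> S" and fg: "f (?g y) = y" if "y \<in> f ` S" for y
    using that by (auto intro: inv_into_into f_inv_into_f)
  have D: "(f has_derivative ?D x) (at x)" if "x \<in> S" for x
    using assms(2) that by (rule smooth_on_has_derivative)
  have lin: "linear (?D (?g y))" if "y \<in> f ` S" for y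
    using D[OF gS[OF that]] by (rule has_derivative_linear)
  have "\<exists>R. linear R \<and> (\<forall>b. R (?D (?g y) b) = b) \<and> (\<forall>v. ?D (?g y) (R v) = v)" if "y \<in> f ` S" for y
    using linear_injective_isomorphism[OF lin[OF that] inj[OF gS[OF that]]] assms(4) by simp
  then obtain R where Rlin: "\<And>y. y \<in> f ` S \<Longrightarrow> linear (R y)"
    and R1: "\<And>y b. y \<in> f ` S \<Longrightarrow> R y (?D (?g y) b) = b"
    and R2: "\<And>y v. y \<in> f ` S \<Longrightarrow> ?D (?g y) (R y v) = v"
    by metis
  have dg: "(?g has_derivative R y) (at y)" if y: "y \<in> f ` S" for y
  proof (rule has_derivative_inverse_basic[OF D[OF gS[OF y]] _ _ _ opn y fg])
    show "bounded_linear (R y)"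
      using Rlin[OF y] by (simp add: linear_conv_bounded_linear)
    show "R y \<circ> ?D (?g y) = id"
      using R1[OF y] by auto
    show "continuous (at y) ?g"
      using cont opn y continuous_on_eq_continuous_at by blast
  qed
  have "Ck_on k (f ` S) ?g" for k
  proof (induction k)
    case 0
    then show ?case using cont by simp
  next
    case (Suc k)
    have Dg: "Ck_on k (f ` S) (\<lambda>y. ?D (?g y) b)" for b
    proof (rule Ck_on_compose[OF opn assms(1) _ Suc, where g = "\<lambda>x. ?D x b"])
      show "?g ` f ` S \<subseteq> S"
        using gS by blast
      show "Ck_on k S (\<lambda>x. ?D x b)"
        using smooth_on_derivative[OF assms(2)] by (simp add: smooth_on_def)
    qed
    have "Ck_on k (f ` S) (\<lambda>y. R y v)" for v
      by (rule Ck_on_linear_solution[OF opn lin Rlin R1 R2 Dg])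
    with dg show ?case
      by (intro Ck_on_SucI[OF opn])
  qed
  with assms opn show ?thesis
    by (auto simp: smoothly_invertible_on_def smooth_on_def)
qed

text \<open>A criterion without derivatives: a smooth left inverse coincides with
  \<open>inv_into S f\<close> on the image, and the image is open by invariance of domain.\<close>

lemma smoothly_invertible_on_left_inverse:
  fixes f :: "'a::euclidean_space \<Rightarrow> 'b::euclidean_space"
  assumes "open S" "smooth_on S f" "open T" "smooth_on T g" "f ` S \<subseteq> T" "DIM('a) = DIM('b)"
    and gf: "\<And>x. x \<in> S \<Longrightarrow> g (f x) = x"
  shows "smoothly_invertible_on S f"
proof -
  have inj: "inj_on f S"
    using gf by (rule inj_on_inverseI)
  have opn: "open (f ` S)"
    using assms inj smooth_on_imp_continuous_on by (intro invariance_of_domain_gen) auto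
  have "smooth_on (f ` S) (inv_into S f)"
    by (rule smooth_on_cong[OF opn _ smooth_on_subset[OF assms(4,5)]]) (use gf inj in auto)
  with assms(2) inj opn show ?thesis
    by (simp add: smoothly_invertible_on_def)
qed

lemma smoothly_invertible_on_compose:
  fixes f :: "'a::euclidean_space \<Rightarrow> 'b::euclidean_space" and g :: "'b \<Rightarrow> 'c::euclidean_space"
  assumes "smoothly_invertible_on S f" "smoothly_invertible_on T g" "open S" "open T" "f ` S \<subseteq> T"
    and "DIM('a) = DIM('c)"
  shows "smoothly_invertible_on S (\<lambda>x. g (f x))"
proof -
  note f = assms(1)[unfolded smoothly_invertible_on_def]
    and g = assms(2)[unfolded smoothly_invertible_on_def]
  let ?f' = "inv_into S f" and ?g' = "inv_into T g"
  let ?O = "g ` T \<inter> ?g' -` (f ` S)"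
  have opn: "open ?O"
    using f g by (intro continuous_open_preimage) (auto intro: smooth_on_imp_continuous_on)
  show ?thesis
  proof (rule smoothly_invertible_on_left_inverse[OF assms(3) _ opn, where g = "\<lambda>z. ?f' (?g' z)"])
    show "smooth_on S (\<lambda>x. g (f x))"
      by (rule smooth_on_compose[of S T]) (use assms f g in auto)
    show "smooth_on ?O (\<lambda>z. ?f' (?g' z))"
      by (rule smooth_on_compose[of ?O "f ` S"]) (use f g opn in \<open>auto intro: smooth_on_subset\<close>)
    show "(\<lambda>x. g (f x)) ` S \<subseteq> ?O"
      using assms(5) g by auto
    show "?f' (?g' (g (f x))) = x" if "x \<in> S" for x
      using that assms(5) f g by (simp add: image_subset_iff)
  qed fact
qed

lemma smoothly_invertible_on_derivative:
  fixes f :: "'a::euclidean_space \<Rightarrow> 'b::euclidean_space"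
  assumes "smoothly_invertible_on S f" "x \<in> S" "open S"
  shows "frechet_derivative (inv_into S f) (at (f x)) \<circ> frechet_derivative f (at x) = id"
proof -
  let ?g = "inv_into S f"
  have f: "(f has_derivative frechet_derivative f (at x)) (at x)"
    and g: "(?g has_derivative frechet_derivative ?g (at (f x))) (at (f x))"
    using assms by (auto simp: smoothly_invertible_on_def intro!: smooth_on_has_derivative)
  have "((\<lambda>y. y) has_derivative (frechet_derivative ?g (at (f x)) \<circ> frechet_derivative f (at x))) (at x)"
    by (rule has_derivative_transform_within_open[OF diff_chain_at[OF f g] assms(3,2)])
      (use assms(1) in \<open>auto simp: smoothly_invertible_on_def\<close>)
  then show ?thesis
    using has_derivative_unique has_derivative_ident unfolding id_def by blast
qed

lemma smoothly_invertible_on_inj_derivative: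
  fixes f :: "'a::euclidean_space \<Rightarrow> 'b::euclidean_space"
  assumes "smoothly_invertible_on S f" "x \<in> S" "open S"
  shows "inj (frechet_derivative f (at x))"
  using smoothly_invertible_on_derivative[OF assms] by (metis inj_on_id inj_on_imageI2)

lemma smoothly_invertible_on_surj_derivative_inverse:
  fixes f :: "'a::euclidean_space \<Rightarrow> 'b::euclidean_space"
  assumes "smoothly_invertible_on S f" "x \<in> S" "open S"
  shows "surj (frechet_derivative (inv_into S f) (at (f x)))"
  using smoothly_invertible_on_derivative[OF assms] by (metis comp_apply id_apply surjI)

text \<open>Two separate facts meet: \<open>f\<close> is injective on a ball around
  \<open>x\<close>, and its derivative stays injective near \<open>x\<close>. On the intersection
  \<open>smoothly_invertible_onI\<close> applies.\<close>

theorem smooth_local_inverse: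
  fixes f :: "'a::euclidean_space \<Rightarrow> 'b::euclidean_space"
  assumes "open S" "smooth_on S f" "x \<in> S" "inj (frechet_derivative f (at x))" "DIM('a) = DIM('b)"
  obtains N where "open N" "x \<in> N" "N \<subseteq> S" "smoothly_invertible_on N f"
proof -
  let ?D = "\<lambda>x. frechet_derivative f (at x)"
  have D: "(f has_derivative ?D y) (at y)" if "y \<in> S" for y
    using assms(2) that by (rule smooth_on_has_derivative)
  then have lin: "linear (?D y)" if "y \<in> S" for y
    using that has_derivative_linear by blast
  have ev: "\<forall>\<^sub>F y in nhds x. y \<in> S"
    using assms(1,3) by (rule eventually_nhds_in_open)
  have cont: "continuous (at x) (\<lambda>y. ?D y b)" for b
    using smooth_on_imp_continuous_on[OF smooth_on_derivative[OF assms(2)]] assms(1,3)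
    by (simp add: continuous_on_eq_continuous_at)
  obtain c where c: "c > 0" "\<forall>\<^sub>F y in nhds x. \<forall>v. c * norm v \<le> norm (?D y v)"
    by (rule eventually_bounded_below_linear[OF _ assms(4) cont])
      (use ev lin in \<open>auto elim: eventually_mono\<close>)
  then obtain N1 where N1: "open N1" "x \<in> N1" "\<And>y v. y \<in> N1 \<Longrightarrow> c * norm v \<le> norm (?D y v)"
    unfolding eventually_nhds by blast
  have inj: "inj (?D y)" if "y \<in> S \<inter> N1" for y
    unfolding linear_injective_0[OF lin[OF IntD1[OF that]]]
  proof (intro allI impI)
    fix v assume "?D y v = 0"
    then have "c * norm v \<le> 0"
      using N1(3)[of y v] that by simp
    with c(1) show "v = 0"
      by (simp add: mult_le_0_iff)
  qed
  obtain L where L: "linear L" "L \<circ> ?D x = id"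
    using linear_injective_left_inverse[OF lin[OF assms(3)] assms(4)] by blast
  \<comment> \<open>Local injectivity needs continuity of the derivative in operator norm, whereas
    smoothness gives it vector by vector. The constant \<open>e'\<close> adds up to the bound
    \<open>e / 2\<close> over the basis, which leaves room for the strict inequality.\<close>
  have on: "\<exists>d>0. \<forall>y. dist x y < d \<longrightarrow> onorm (\<lambda>v. ?D y v - ?D x v) < e" if "e > 0" for e
  proof -
    define e' where "e' = e / (2 * DIM('a))"
    have "e' > 0"
      using that by (simp add: e'_def)
    have "\<forall>\<^sub>F y in nhds x. \<forall>b\<in>Basis. norm (?D y b - ?D x b) < e'"
      unfolding eventually_ball_finite_distrib[OF finite_Basis]
    proof
      fix b
      have "((\<lambda>y. ?D y b) \<longlongrightarrow> ?D x b) (nhds x)"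
        using cont[of b] tendsto_at_iff_tendsto_nhds[of "\<lambda>y. ?D y b" x] by (simp add: continuous_at)
      from tendstoD[OF this \<open>e' > 0\<close>] show "\<forall>\<^sub>F y in nhds x. norm (?D y b - ?D x b) < e'"
        by (simp add: dist_norm)
    qed
    then have "\<forall>\<^sub>F y in nhds x. onorm (\<lambda>v. ?D y v - ?D x v) < e"
      using ev
    proof eventually_elim
      case (elim y)
      have "linear (\<lambda>v. ?D y v - ?D x v)"
        using lin elim(2) assms(3) by (intro linear_compose_sub)
      then have *: "?D y v - ?D x v = (\<Sum>b\<in>Basis. (v \<bullet> b) *\<^sub>R (?D y b - ?D x b))" for v
        by (rule linear_expand_basis)
      have "norm (?D y v - ?D x v) \<le> e / 2 * norm v" for v
      proof -
        have "norm (?D y v - ?D x v) \<le> (\<Sum>b\<in>(Basis::'a set). norm v * e')"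
          unfolding *[of v]
        proof (rule sum_norm_le)
          fix b :: 'a assume b: "b \<in> Basis"
          show "norm ((v \<bullet> b) *\<^sub>R (?D y b - ?D x b)) \<le> norm v * e'"
            using Basis_le_norm[OF b, of v] elim(1) b less_imp_le by (auto intro!: mult_mono)
        qed
        then show ?thesis by (simp add: e'_def mult_ac)
      qed
      then have "onorm (\<lambda>v. ?D y v - ?D x v) \<le> e / 2"
        using that by (intro onorm_bound) auto
      with that show ?case by simp
    qed
    then show ?thesis
      by (auto simp: eventually_nhds_metric dist_commute)
  qed
  obtain r where r: "r > 0" "ball x r \<subseteq> S" "inj_on f (ball x r)"
    by (rule has_derivative_locally_injective[OF assms(3,1) _ L(2) D on])
      (use L in \<open>auto simp: linear_conv_bounded_linear\<close>)
  let ?N = "ball x r \<inter> N1"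
  have "smoothly_invertible_on ?N f"
    using r N1 inj assms(2,5)
    by (intro smoothly_invertible_onI) (auto intro: smooth_on_subset inj_on_subset)
  then show thesis
    using r N1 by (intro that[of ?N]) auto
qed

section \<open>Local transformation groups\<close>

lemma smooth_atlas_chart:
  assumes "smooth_atlas \<A>" "(C, c) \<in> \<A>"
  shows "open C" "open (c ` C)" "homeomorphism C (c ` C) c (inv_into C c)"
  using assms unfolding smooth_atlas_def by fast+

lemma open_chart_domain:
  assumes "smooth_atlas \<A>" "(C, c) \<in> \<A>" "open D"
  shows "open {(t, \<xi>). t \<in> c ` C \<and> (inv_into C c t, \<xi>) \<in> D}"
proof -
  note C = smooth_atlas_chart[OF assms(1,2)]
  have "continuous_on (c ` C \<times> UNIV) (\<lambda>p. (inv_into C c (fst p), snd p))"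
    using C(3)
    by (auto simp: homeomorphism_def intro!: continuous_intros
        continuous_on_compose2[of "c ` C" "inv_into C c" _ fst])
  then have "open ((c ` C \<times> UNIV) \<inter> (\<lambda>p. (inv_into C c (fst p), snd p)) -` D)"
    using C(2) assms(3) by (intro continuous_open_preimage open_Times) auto
  also have "\<dots> = {(t, \<xi>). t \<in> c ` C \<and> (inv_into C c t, \<xi>) \<in> D}"
    by auto
  finally show ?thesis .
qed

text \<open>Makes the pair \<open>(x, u)\<close> a single point under one action; the domain asks
  that the same \<open>g\<close> can move both components.\<close>

lemma local_transformation_group_product:
  assumes "smooth_atlas \<A>"
    and 1: "local_transformation_group \<A> \<Sigma>1 D1 \<phi>" and 2: "local_transformation_group \<A> \<Sigma>2 D2 \<psi>"
  shows "local_transformation_group \<A> (\<Sigma>1 \<times> \<Sigma>2) {(g, x, u). (g, x) \<in> D1 \<and> (g, u) \<in> D2}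
    (\<lambda>g (x, u). (\<phi> g x, \<psi> g u))"
    (is "local_transformation_group _ _ ?D ?\<tau>")
proof -
  note 1 = 1[unfolded local_transformation_group_def]
    and 2 = 2[unfolded local_transformation_group_def]
  have "open ((\<lambda>p. (fst p, fst (snd p))) -` D1 \<inter> (\<lambda>p. (fst p, snd (snd p))) -` D2)"
    using 1 2 by (intro open_Int open_vimage continuous_intros) auto
  also have "(\<lambda>p. (fst p, fst (snd p))) -` D1 \<inter> (\<lambda>p. (fst p, snd (snd p))) -` D2 = ?D"
    by auto
  finally have D: "open ?D" .
  have smooth: "smooth_on {(t, z). t \<in> c ` C \<and> (inv_into C c t, z) \<in> ?D} (\<lambda>(t, z). ?\<tau> (inv_into C c t) z)"
    (is "smooth_on ?P _") if C: "(C, c) \<in> \<A>" for C c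
  proof -
    have P: "open ?P"
      by (rule open_chart_domain[OF assms(1) C D])
    have p1: "smooth_on ?P (\<lambda>p. (fst p, fst (snd p)))" and p2: "smooth_on ?P (\<lambda>p. (fst p, snd (snd p)))"
      by (intro smooth_on_Pair smooth_on_fst smooth_on_snd smooth_on_ident P)+
    have s1: "smooth_on ?P (\<lambda>p. (\<lambda>(t, \<xi>). \<phi> (inv_into C c t) \<xi>) (fst p, fst (snd p)))"
      by (rule smooth_on_compose[OF P open_chart_domain[OF assms(1) C] _ p1]) (use 1 C in auto)
    have s2: "smooth_on ?P (\<lambda>p. (\<lambda>(t, \<xi>). \<psi> (inv_into C c t) \<xi>) (fst p, snd (snd p)))"
      by (rule smooth_on_compose[OF P open_chart_domain[OF assms(1) C] _ p2]) (use 2 C in auto)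
    show ?thesis
      by (rule smooth_on_cong[OF P _ smooth_on_Pair[OF P s1 s2]]) auto
  qed
  show ?thesis
    unfolding local_transformation_group_def
  proof (intro conjI)
    show "\<forall>(C, c)\<in>\<A>. smooth_on {(t, z). t \<in> c ` C \<and> (inv_into C c t, z) \<in> ?D}
        (\<lambda>(t, z). ?\<tau> (inv_into C c t) z)"
      using smooth by blast
    show "open ?D" by (rule D)
  qed (use 1 2 in \<open>auto intro!: open_Times\<close>)
qed

text \<open>One chart around the identity is enough, as every statement concerns group elements near
  0.\<close>

locale chart_action =
  fixes \<A> :: "('g::{topological_group_add, t2_space, second_countable_topology}, 'r::finite) atlas"
    and C :: "'g set" and c :: "'g \<Rightarrow> real^'r"
    and \<Sigma> :: "'a::euclidean_space set" and D :: "('g \<times> 'a) set" and \<tau> :: "'g \<Rightarrow> 'a \<Rightarrow> 'a"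
  assumes atlas: "smooth_atlas \<A>" and chart: "(C, c) \<in> \<A>" and zero_in_chart: "0 \<in> C"
    and action: "local_transformation_group \<A> \<Sigma> D \<tau>"
begin

abbreviation \<gamma> :: "real^'r \<Rightarrow> 'g" where "\<gamma> \<equiv> inv_into C c"

abbreviation dom :: "((real^'r) \<times> 'a) set" where "dom \<equiv> {(t, \<xi>). t \<in> c ` C \<and> (\<gamma> t, \<xi>) \<in> D}"

lemma open_chart: "open C" "open (c ` C)"
  and chart_homeo: "homeomorphism C (c ` C) c \<gamma>"
  using smooth_atlas_chart[OF atlas chart] by auto

lemma chart_inverse: "g \<in> C \<Longrightarrow> \<gamma> (c g) = g" "t \<in> c ` C \<Longrightarrow> c (\<gamma> t) = t" "t \<in> c ` C \<Longrightarrow> \<gamma> t \<in> C"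
  using chart_homeo by (auto simp: homeomorphism_def)

lemma open_action: "open \<Sigma>" "open D"
  and zero_in_dom: "\<xi> \<in> \<Sigma> \<Longrightarrow> (0, \<xi>) \<in> D"
  and dom_subset: "(g, \<xi>) \<in> D \<Longrightarrow> \<xi> \<in> \<Sigma>"
  and action_closed: "(g, \<xi>) \<in> D \<Longrightarrow> \<tau> g \<xi> \<in> \<Sigma>"
  and action_zero: "\<xi> \<in> \<Sigma> \<Longrightarrow> \<tau> 0 \<xi> = \<xi>"
  and action_add: "(g1, \<xi>) \<in> D \<Longrightarrow> (g2, \<tau> g1 \<xi>) \<in> D \<Longrightarrow> (g2 + g1, \<xi>) \<in> D \<Longrightarrow>
    \<tau> g2 (\<tau> g1 \<xi>) = \<tau> (g2 + g1) \<xi>"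
  and smooth_action: "smooth_on dom (\<lambda>(t, \<xi>). \<tau> (\<gamma> t) \<xi>)"
  using action chart unfolding local_transformation_group_def by blast+

text \<open>The third domain condition of the composition law is automatic:
  \<open>- g + g = 0\<close>, and \<open>(0, \<xi>)\<close> lies in \<open>D\<close> for all
  \<open>\<xi>\<close> in \<open>\<Sigma>\<close>.\<close>

lemma action_inverse:
  assumes "(g, \<xi>) \<in> D" "(- g, \<tau> g \<xi>) \<in> D"
  shows "\<tau> (- g) (\<tau> g \<xi>) = \<xi>"
  using action_add[OF assms] assms(1) dom_subset zero_in_dom action_zero by fastforce

lemma open_dom: "open dom"
  by (rule open_chart_domain[OF atlas chart open_action(2)])

lemma tendsto_chart: "(a \<longlongrightarrow> g) F \<Longrightarrow> g \<in> C \<Longrightarrow> ((\<lambda>z. c (a z)) \<longlongrightarrow> c g) F"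
  using chart_homeo open_chart(1)
  by (auto simp: homeomorphism_def continuous_on_eq_continuous_at intro: isCont_tendsto_compose)

lemma tendsto_chart_inverse: "(a \<longlongrightarrow> t) F \<Longrightarrow> t \<in> c ` C \<Longrightarrow> ((\<lambda>z. \<gamma> (a z)) \<longlongrightarrow> \<gamma> t) F"
  using chart_homeo open_chart(2) isCont_tendsto_compose[of t \<gamma> a F]
  by (auto simp: homeomorphism_def continuous_on_eq_continuous_at)

text \<open>Smoothness of the action is stated in coordinates; this is the resulting joint
  continuity in terms of group elements. The values \<open>a z\<close> lie in the chart only
  eventually, which suffices for a limit.\<close>

lemma tendsto_action:
  assumes "(a \<longlongrightarrow> g) F" "(b \<longlongrightarrow> \<xi>) F" "g \<in> C" "(g, \<xi>) \<in> D"
  shows "((\<lambda>z. \<tau> (a z) (b z)) \<longlongrightarrow> \<tau> g \<xi>) F"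
proof -
  let ?\<Phi> = "\<lambda>(t, \<xi>). \<tau> (\<gamma> t) \<xi>"
  have "(c g, \<xi>) \<in> dom"
    using assms(3,4) by (auto simp: chart_inverse)
  then have "isCont ?\<Phi> (c g, \<xi>)"
    using smooth_on_imp_continuous_on[OF smooth_action] open_dom continuous_on_eq_continuous_at by blast
  from isCont_tendsto_compose[OF this tendsto_Pair[OF tendsto_chart[OF assms(1,3)] assms(2)]]
  have "((\<lambda>z. \<tau> (\<gamma> (c (a z))) (b z)) \<longlongrightarrow> \<tau> g \<xi>) F"
    using assms(3) by (simp add: chart_inverse)
  moreover have "\<forall>\<^sub>F z in F. a z \<in> C"
    using assms(1) open_chart(1) assms(3) by (rule topological_tendstoD)
  then have "\<forall>\<^sub>F z in F. \<tau> (\<gamma> (c (a z))) (b z) = \<tau> (a z) (b z)"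
    by eventually_elim (simp add: chart_inverse)
  ultimately show ?thesis
    by (rule Lim_transform_eventually)
qed

lemma smooth_on_action:
  fixes S :: "'b::euclidean_space set"
  assumes "open S" "smooth_on S a" "smooth_on S b"
    and "\<And>z. z \<in> S \<Longrightarrow> a z \<in> c ` C \<and> (\<gamma> (a z), b z) \<in> D"
  shows "smooth_on S (\<lambda>z. \<tau> (\<gamma> (a z)) (b z))"
proof -
  have "smooth_on S (\<lambda>z. (\<lambda>(t, \<xi>). \<tau> (\<gamma> t) \<xi>) (a z, b z))"
    by (rule smooth_on_compose[OF assms(1) open_dom _ smooth_on_Pair[OF assms(1-3)] smooth_action])
      (use assms(4) in auto)
  then show ?thesis by simp
qed

lemma orbit_has_derivative:
  assumes "\<xi> \<in> \<Sigma>"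
  shows "((\<lambda>t. \<tau> (\<gamma> t) \<xi>) has_derivative frechet_derivative (\<lambda>t. \<tau> (\<gamma> t) \<xi>) (at (c 0))) (at (c 0))"
proof -
  define Q where "Q = (\<lambda>t. (t, \<xi>)) -` dom"
  have Q: "open Q"
    unfolding Q_def by (intro open_vimage open_dom continuous_intros)
  have "smooth_on Q (\<lambda>t. \<tau> (\<gamma> t) \<xi>)"
    by (rule smooth_on_action[OF Q smooth_on_ident[OF Q] smooth_on_const[OF Q]]) (auto simp: Q_def)
  then show ?thesis
    by (rule smooth_on_has_derivative)
      (use zero_in_chart zero_in_dom[OF assms] in \<open>auto simp: Q_def chart_inverse\<close>)
qed

text \<open>
  A slice \<open>z0 + S k\<close> through \<open>z0\<close> transversal to the orbit of \<open>z0\<close> is swept out diffeomorphically by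
  the group elements near the identity.
\<close>

lemma flow_box_exists:
  assumes z0: "z0 \<in> \<Sigma>" and inj: "inj (frechet_derivative (\<lambda>t. \<tau> (\<gamma> t) z0) (at (c 0)))"
    and dim: "CARD('r) + CARD('k::finite) = DIM('a)"
  obtains S :: "real^'k \<Rightarrow> 'a" and N
  where "linear S" "open N" "(c 0, 0) \<in> N" "(\<lambda>(t, k). (t, z0 + S k)) ` N \<subseteq> dom"
    "smoothly_invertible_on N (\<lambda>(t, k). \<tau> (\<gamma> t) (z0 + S k))"
proof -
  let ?A = "frechet_derivative (\<lambda>t. \<tau> (\<gamma> t) z0) (at (c 0))"
  have c0: "(c 0, z0) \<in> dom"
    using zero_in_chart zero_in_dom[OF z0] by (auto simp: chart_inverse)
  note A = orbit_has_derivative[OF z0]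
  then have linA: "linear ?A"
    by (rule has_derivative_linear)
  \<comment> \<open>The range of \<open>?A\<close> is the tangent space of the orbit at
    \<open>z0\<close>; its orthogonal complement has dimension \<open>CARD('k)\<close> and gives the
    directions of the slice.\<close>
  define T where "T = {y. \<forall>x\<in>range ?A. orthogonal x y}"
  have "dim (range ?A) = CARD('r)"
    using dim_image_eq[OF linA, of UNIV] inj by simp
  then have "dim T = CARD('k)"
    using dim_subspace_orthogonal_to_vectors[of "range ?A" UNIV] dim
      linear_subspace_image[OF linA subspace_UNIV]
    by (simp add: T_def)
  then obtain S :: "real^'k \<Rightarrow> 'a" where S: "linear S" "S ` UNIV = T" "inj S"
    using subspace_isomorphism[of "UNIV :: (real^'k) set" T] subspace_orthogonal_to_vectors[of "range ?A"]
    by (auto simp: T_def)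
  define \<Theta> where "\<Theta> = (\<lambda>(t, k). \<tau> (\<gamma> t) (z0 + S k))"
  define Q where "Q = (\<lambda>(t, k). (t, z0 + S k)) -` dom"
  have blS: "bounded_linear S"
    using S(1) by (simp add: linear_conv_bounded_linear)
  have "continuous_on UNIV (\<lambda>(t, k). (t, z0 + S k))"
    unfolding case_prod_unfold
    by (intro continuous_intros bounded_linear.continuous_on[OF blS])
  then have Q: "open Q" "(c 0, 0) \<in> Q"
    using open_vimage[OF open_dom] c0 linear_0[OF S(1)] by (auto simp: Q_def)
  have "smooth_on Q (\<lambda>p. \<tau> (\<gamma> (fst p)) (z0 + S (snd p)))"
    by (rule smooth_on_action[OF Q(1)])
      (auto simp: Q_def[symmetric] intro!: smooth_on_fst smooth_on_add smooth_on_const smooth_on_ident Q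
        smooth_on_bounded_linear[OF _ blS] smooth_on_snd, auto simp: Q_def)
  then have sm: "smooth_on Q \<Theta>"
    by (simp add: \<Theta>_def case_prod_unfold)
  let ?D = "frechet_derivative \<Theta> (at (c 0, 0))"
  note D = smooth_on_has_derivative[OF sm Q(2)]
  have linD: "linear ?D"
    using D by (rule has_derivative_linear)
  have "((\<lambda>t. \<Theta> (t, 0)) has_derivative (\<lambda>h. ?D (h, 0))) (at (c 0))"
    using diff_chain_at[OF bounded_linear_imp_has_derivative[OF bounded_linear_Pair_zero(1)], of \<Theta> ?D "c 0"] D
    by (simp add: o_def)
  moreover have "(\<lambda>t. \<Theta> (t, 0)) = (\<lambda>t. \<tau> (\<gamma> t) z0)"
    using linear_0[OF S(1)] by (simp add: \<Theta>_def)
  ultimately have D1: "?D (h, 0) = ?A h" for h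
    using has_derivative_unique[OF A] by metis
  \<comment> \<open>The identity element fixes the slice pointwise, which identifies the derivative
    in the slice directions with \<open>S\<close>. It holds only for small \<open>k\<close>, because
    \<open>z0 + S k\<close> has to stay in \<open>\<Sigma>\<close>.\<close>
  have ev: "\<forall>\<^sub>F k in nhds 0. \<Theta> (c 0, k) = z0 + S k"
  proof -
    have "((\<lambda>k. z0 + S k) \<longlongrightarrow> z0 + S 0) (nhds 0)"
      by (intro tendsto_intros bounded_linear.tendsto[OF blS] filterlim_ident)
    then have "\<forall>\<^sub>F k in nhds 0. z0 + S k \<in> \<Sigma>"
      using z0 linear_0[OF S(1)] by (intro topological_tendstoD[OF _ open_action(1)]) auto
    then show ?thesis
      by eventually_elim (simp add: \<Theta>_def chart_inverse zero_in_chart action_zero)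
  qed
  have "((\<lambda>k. (c 0, k)) has_derivative (\<lambda>h. (0, h))) (at 0)"
    by (auto intro!: derivative_eq_intros)
  from diff_chain_at[OF this D]
  have "((\<lambda>k. \<Theta> (c 0, k)) has_derivative (\<lambda>h. ?D (0, h))) (at 0)"
    by (simp add: o_def)
  moreover have "((\<lambda>k. \<Theta> (c 0, k)) has_derivative S) (at 0)"
  proof -
    have "((\<lambda>k. z0 + S k) has_derivative (\<lambda>h. 0 + S h)) (at 0)"
      by (intro has_derivative_add has_derivative_const bounded_linear_imp_has_derivative blS)
    moreover obtain B where "open B" "0 \<in> B" "\<And>k. k \<in> B \<Longrightarrow> \<Theta> (c 0, k) = z0 + S k"
      using ev unfolding eventually_nhds by blast
    ultimately show ?thesis
      using has_derivative_transform_within_open[of "\<lambda>k. z0 + S k" S 0 UNIV B "\<lambda>k. \<Theta> (c 0, k)"] by simp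
  qed
  ultimately have D2: "?D (0, h) = S h" for h
    using has_derivative_unique by metis
  \<comment> \<open>Orbit and slice directions are orthogonal, so \<open>?A t + S k = 0\<close>
    forces both summands to vanish, and \<open>?A\<close> and \<open>S\<close> are
    injective.\<close>
  have "inj ?D"
    unfolding linear_injective_0[OF linD]
  proof (intro allI impI)
    fix p assume p: "?D p = 0"
    obtain t k where tk: "p = (t, k)" by (cases p)
    have "?D p = ?A t + S k"
      using linear_add[OF linD, of "(t, 0)" "(0, k)"] by (simp add: tk D1 D2)
    then have "?A t = - S k"
      using p by (simp add: eq_neg_iff_add_eq_0)
    moreover have "orthogonal (?A t) (S k)"
      using S(2) unfolding T_def by blast
    ultimately have "S k = 0" "?A t = 0"
      by (auto simp: orthogonal_def)
    then show "p = 0"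
      using S(1,3) linA inj by (simp add: tk linear_injective_0 zero_prod_def)
  qed
  then obtain N where "open N" "(c 0, 0) \<in> N" "N \<subseteq> Q" "smoothly_invertible_on N \<Theta>"
    using smooth_local_inverse[OF Q(1) sm Q(2)] dim by auto
  with S(1) show thesis
    by (intro that[of S N]) (auto simp: Q_def \<Theta>_def)
qed

end

section \<open>Flow boxes and the coordinates they define\<close>

lemma tendsto_nhds_Pair:
  "(fst \<longlongrightarrow> a) (nhds (a, b))" "(snd \<longlongrightarrow> b) (nhds (a, b))"
  using tendsto_fst[OF filterlim_ident[of "nhds (a, b)"]] tendsto_snd[OF filterlim_ident[of "nhds (a, b)"]]
  by simp_all

text \<open>The chart is not normalised: \<open>z0\<close> has the coordinates
  \<open>(c 0, 0)\<close>, and \<open>c 0\<close> need not be the origin.\<close>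

locale flow_box = chart_action \<A> C c \<Sigma> D \<tau>
  for \<A> :: "('g::{topological_group_add, t2_space, second_countable_topology}, 'r::finite) atlas"
    and C c and \<Sigma> :: "'a::euclidean_space set" and D \<tau> +
  fixes z0 :: 'a and S :: "real^'k::finite \<Rightarrow> 'a" and N :: "((real^'r) \<times> (real^'k)) set"
  assumes base: "z0 \<in> \<Sigma>" and linear_slice: "linear S"
    and open_box_coordinates: "open N" and base_in_box_coordinates: "(c 0, 0) \<in> N"
    and box_coordinates: "(\<lambda>(t, k). (t, z0 + S k)) ` N \<subseteq> dom"
    and invertible_box: "smoothly_invertible_on N (\<lambda>(t, k). \<tau> (\<gamma> t) (z0 + S k))"
begin

definition \<Theta> :: "(real^'r) \<times> (real^'k) \<Rightarrow> 'a" where "\<Theta> = (\<lambda>(t, k). \<tau> (\<gamma> t) (z0 + S k))"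

abbreviation box :: "'a set" where "box \<equiv> \<Theta> ` N"

definition \<Psi> :: "'a \<Rightarrow> (real^'r) \<times> (real^'k)" where "\<Psi> = inv_into N \<Theta>"

text \<open>The group coordinate of the box as a group element: \<open>time z\<close> carries the
  slice point \<open>foot z\<close> to \<open>z\<close>. Its negative brings \<open>z\<close> back
  to the slice.\<close>

definition time :: "'a \<Rightarrow> 'g" where "time z = \<gamma> (fst (\<Psi> z))"

definition foot :: "'a \<Rightarrow> 'a" where "foot z = z0 + S (snd (\<Psi> z))"

lemma bounded_linear_slice: "bounded_linear S"
  using linear_slice by (simp add: linear_conv_bounded_linear)

lemma invertible_\<Theta>: "smoothly_invertible_on N \<Theta>"
  using invertible_box by (simp add: \<Theta>_def)

lemma inj_\<Theta>: "inj_on \<Theta> N" and open_box: "open box" and smooth_\<Psi>: "smooth_on box \<Psi>"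
  using invertible_\<Theta> by (simp_all add: smoothly_invertible_on_def \<Psi>_def)

lemma \<Psi>_inverse: "p \<in> N \<Longrightarrow> \<Psi> (\<Theta> p) = p" "z \<in> box \<Longrightarrow> \<Theta> (\<Psi> z) = z" "z \<in> box \<Longrightarrow> \<Psi> z \<in> N"
  by (auto simp: \<Psi>_def inj_\<Theta>)

lemma box_coordinatesD: "(t, k) \<in> N \<Longrightarrow> t \<in> c ` C" "(t, k) \<in> N \<Longrightarrow> (\<gamma> t, z0 + S k) \<in> D"
  using box_coordinates by auto

lemma \<Theta>_base: "\<Theta> (c 0, 0) = z0"
  using base linear_0[OF linear_slice] by (simp add: \<Theta>_def chart_inverse zero_in_chart action_zero)

lemma base_in_box: "z0 \<in> box"
  using base_in_box_coordinates \<Theta>_base by (metis imageI)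

lemma \<Psi>_base: "\<Psi> z0 = (c 0, 0)"
  using \<Psi>_inverse(1)[OF base_in_box_coordinates] by (simp add: \<Theta>_base)

lemma time_base: "time z0 = 0" and foot_base: "foot z0 = z0"
  using linear_0[OF linear_slice]
  by (simp_all add: time_def foot_def \<Psi>_base chart_inverse zero_in_chart)

lemma
  assumes "z \<in> box"
  shows time_in_chart: "time z \<in> C" "fst (\<Psi> z) \<in> c ` C"
    and time_foot: "(time z, foot z) \<in> D" "\<tau> (time z) (foot z) = z"
  using \<Psi>_inverse(2,3)[OF assms] box_coordinatesD[of "fst (\<Psi> z)" "snd (\<Psi> z)"]
  by (auto simp: time_def foot_def \<Theta>_def case_prod_unfold chart_inverse)

lemma box_subset: "box \<subseteq> \<Sigma>"
  using time_foot action_closed by fastforce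

lemma tendsto_\<Psi>: "z \<in> box \<Longrightarrow> (a \<longlongrightarrow> z) F \<Longrightarrow> ((\<lambda>x. \<Psi> (a x)) \<longlongrightarrow> \<Psi> z) F"
  using smooth_on_imp_continuous_on[OF smooth_\<Psi>] open_box
  by (metis continuous_on_eq_continuous_at isCont_tendsto_compose)

lemma tendsto_time: "z \<in> box \<Longrightarrow> (a \<longlongrightarrow> z) F \<Longrightarrow> ((\<lambda>x. time (a x)) \<longlongrightarrow> time z) F"
  unfolding time_def by (intro tendsto_chart_inverse tendsto_fst tendsto_\<Psi> time_in_chart)

lemma tendsto_foot: "z \<in> box \<Longrightarrow> (a \<longlongrightarrow> z) F \<Longrightarrow> ((\<lambda>x. foot (a x)) \<longlongrightarrow> foot z) F"
  unfolding foot_def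
  by (intro tendsto_intros bounded_linear.tendsto[OF bounded_linear_slice] tendsto_snd tendsto_\<Psi>)

lemma eventually_box: "\<forall>\<^sub>F z in nhds z0. z \<in> box"
  using open_box base_in_box by (rule eventually_nhds_in_open)

text \<open>
  \<open>\<tau> g z\<close> is \<open>\<tau> (g + time z) (foot z)\<close>, and coordinates in the box are unique.
\<close>

lemma box_equivariant:
  assumes z: "z \<in> box"
  shows "\<forall>\<^sub>F p in nhds (0, z). time (\<tau> (fst p) (snd p)) = fst p + time (snd p) \<and>
    snd (\<Psi> (\<tau> (fst p) (snd p))) = snd (\<Psi> (snd p))"
proof -
  let ?F = "nhds (0::'g, z)"
  define a where "a p = fst p + time (snd p)" for p
  \<comment> \<open>The expected coordinates of \<open>\<tau> g z\<close>. They tend to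
    \<open>\<Psi> z\<close>, so they lie in \<open>N\<close> eventually; membership in
    \<open>N\<close> also supplies the last domain condition of the composition law.\<close>
  define q where "q p = (c (a p), snd (\<Psi> (snd p)))" for p
  have a: "(a \<longlongrightarrow> time z) ?F"
    unfolding a_def using tendsto_add[OF tendsto_nhds_Pair(1)[of 0] tendsto_time[OF z tendsto_nhds_Pair(2)]]
    by simp
  have "(q \<longlongrightarrow> (c (time z), snd (\<Psi> z))) ?F"
    unfolding q_def
    by (intro tendsto_Pair tendsto_chart[OF a] tendsto_snd tendsto_\<Psi>[OF z] tendsto_nhds_Pair
        time_in_chart[OF z])
  moreover have "(c (time z), snd (\<Psi> z)) = \<Psi> z"
    by (simp add: time_def chart_inverse time_in_chart[OF z])
  ultimately have "\<forall>\<^sub>F p in ?F. q p \<in> N"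
    using topological_tendstoD[OF _ open_box_coordinates] \<Psi>_inverse(3)[OF z] by metis
  moreover have "\<forall>\<^sub>F p in ?F. a p \<in> C"
    using topological_tendstoD[OF a open_chart(1) time_in_chart(1)[OF z]] .
  moreover have "\<forall>\<^sub>F p in ?F. snd p \<in> box"
    using topological_tendstoD[OF tendsto_nhds_Pair(2) open_box z] .
  moreover have "\<forall>\<^sub>F p in ?F. p \<in> D"
    using z box_subset zero_in_dom by (intro eventually_nhds_in_open open_action) auto
  ultimately show ?thesis
  proof eventually_elim
    case (elim p)
    have "(a p, foot (snd p)) \<in> D"
      using box_coordinatesD(2)[of "c (a p)" "snd (\<Psi> (snd p))"] elim
      by (simp add: q_def chart_inverse foot_def)
    then have "\<tau> (fst p) (snd p) = \<tau> (a p) (foot (snd p))"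
      using action_add[OF time_foot(1)[OF elim(3)], of "fst p"] elim(4) time_foot(2)[OF elim(3)]
      by (simp add: a_def)
    also have "\<dots> = \<Theta> (q p)"
      using elim(2) by (simp add: \<Theta>_def q_def foot_def chart_inverse)
    finally have "\<Psi> (\<tau> (fst p) (snd p)) = q p"
      using \<Psi>_inverse(1)[OF elim(1)] by simp
    with elim(2) show ?case
      by (simp add: time_def[of "\<tau> (fst p) (snd p)"] q_def chart_inverse a_def)
  qed
qed

text \<open>As \<open>z\<close> tends to \<open>z0\<close>, the pair \<open>(time z, foot z)\<close>
  tends to \<open>(0, z0)\<close>. So invariance near that one pair applies to
  \<open>z = \<tau> (time z) (foot z)\<close>; no regularity of \<open>J\<close> enters.\<close>

lemma eventually_foot:
  assumes "\<forall>\<^sub>F p in nhds (0, z0). J (\<tau> (fst p) (snd p)) = J (snd p)"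
  shows "\<forall>\<^sub>F z in nhds z0. J z = J (foot z)"
proof -
  have "((\<lambda>z. (time z, foot z)) \<longlongrightarrow> (0, z0)) (nhds z0)"
    using tendsto_Pair[OF tendsto_time[OF base_in_box filterlim_ident]
        tendsto_foot[OF base_in_box filterlim_ident]]
    by (simp add: time_base foot_base)
  from eventually_compose_filterlim[OF assms this] eventually_box
  show ?thesis
    by eventually_elim (simp add: time_foot)
qed

lemma full_rank_coordinate:
  assumes "z \<in> box"
  shows "dim (range (frechet_derivative (\<lambda>z. snd (\<Psi> z)) (at z))) = CARD('k)"
proof -
  have "((\<lambda>z. snd (\<Psi> z)) has_derivative (\<lambda>v. snd (frechet_derivative \<Psi> (at z) v))) (at z)"
    by (intro has_derivative_snd smooth_on_has_derivative[OF smooth_\<Psi> assms])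
  from frechet_derivative_at[OF this, symmetric]
  have "range (frechet_derivative (\<lambda>z. snd (\<Psi> z)) (at z)) = snd ` range (frechet_derivative \<Psi> (at z))"
    by auto
  also have "surj (frechet_derivative \<Psi> (at z))"
    using smoothly_invertible_on_surj_derivative_inverse[OF invertible_\<Theta> \<Psi>_inverse(3)[OF assms]
        open_box_coordinates] \<Psi>_inverse(2)[OF assms]
    by (simp add: \<Psi>_def)
  finally show ?thesis
    by simp
qed

text \<open>
  Near \<open>z0\<close> the invariant \<open>I\<close> depends on the foot point only, and by its rank it parametrizes the
  slice. So the foot point of \<open>z\<close> is a smooth function of \<open>I z\<close>.
\<close>

lemma invariant_section:
  fixes I :: "'a \<Rightarrow> real^'k"
  assumes W: "open W" "z0 \<in> W" and I: "smooth_on W I"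
    and inv: "\<forall>\<^sub>F p in nhds (0, z0). I (\<tau> (fst p) (snd p)) = I (snd p)"
    and rank: "dim (range (frechet_derivative I (at z0))) = CARD('k)"
  obtains A s where "open A" "I z0 \<in> A" "smooth_on A s" "s ` A \<subseteq> W" "s (I z0) = z0"
    "\<forall>\<^sub>F z in nhds z0. I z \<in> A \<and> s (I z) = foot z"
proof -
  define i where "i k = I (z0 + S k)" for k
  define Q where "Q = (\<lambda>k. z0 + S k) -` W"
  have S0: "S 0 = 0"
    using linear_slice by (rule linear_0)
  have Q: "open Q" "0 \<in> Q"
    unfolding Q_def using W S0
    by (auto intro!: open_vimage continuous_intros bounded_linear.continuous_on[OF bounded_linear_slice])
  have smQ: "smooth_on T (\<lambda>k. z0 + S k)" if "open T" for T
    by (rule smooth_on_add[OF that smooth_on_const[OF that]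
          smooth_on_bounded_linear[OF that bounded_linear_slice smooth_on_ident[OF that]]])
  have smi: "smooth_on Q i"
    unfolding i_def by (rule smooth_on_compose[OF Q(1) W(1) _ smQ[OF Q(1)] I]) (auto simp: Q_def)
  let ?D = "frechet_derivative i (at 0)"
  note D = smooth_on_has_derivative[OF smi Q(2)]
  \<comment> \<open>Near \<open>z0\<close>, \<open>I\<close> factors through its restriction
    \<open>i\<close> to the slice. Hence the derivative of \<open>i\<close> has at least the range
    of that of \<open>I\<close>, is onto by the rank condition, and is injective by equality of
    dimensions.\<close>
  have "\<forall>\<^sub>F z in nhds z0. i (snd (\<Psi> z)) = I z"
    using eventually_foot[OF inv] by (auto simp: foot_def i_def elim: eventually_mono)
  then obtain B where B: "open B" "z0 \<in> B" "\<And>z. z \<in> B \<Longrightarrow> i (snd (\<Psi> z)) = I z"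
    unfolding eventually_nhds by blast
  have "((\<lambda>z. snd (\<Psi> z)) has_derivative (\<lambda>v. snd (frechet_derivative \<Psi> (at z0) v))) (at z0)"
    by (intro has_derivative_snd smooth_on_has_derivative[OF smooth_\<Psi> base_in_box])
  from diff_chain_at[OF this, of i ?D] D
  have "((\<lambda>z. i (snd (\<Psi> z))) has_derivative (\<lambda>v. ?D (snd (frechet_derivative \<Psi> (at z0) v)))) (at z0)"
    by (simp add: \<Psi>_base o_def)
  then have "(I has_derivative (\<lambda>v. ?D (snd (frechet_derivative \<Psi> (at z0) v)))) (at z0)"
    by (rule has_derivative_transform_within_open[OF _ B])
  from frechet_derivative_at[OF this, symmetric]
  have "range (frechet_derivative I (at z0)) \<subseteq> range ?D"
    by auto
  moreover have "range (frechet_derivative I (at z0)) = UNIV"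
    using rank dim_eq_full[of "range (frechet_derivative I (at z0))"]
      linear_subspace_image[OF has_derivative_linear[OF smooth_on_has_derivative[OF I W(2)]] subspace_UNIV]
    by (simp add: span_eq_iff[THEN iffD2])
  ultimately have "surj ?D" by auto
  then have "inj ?D"
    using linear_surjective_imp_injective[OF has_derivative_linear[OF D]] by simp
  then obtain M where M: "open M" "0 \<in> M" "M \<subseteq> Q" "smoothly_invertible_on M i"
    using smooth_local_inverse[OF Q(1) smi Q(2)] by auto
  note Mi = M(4)[unfolded smoothly_invertible_on_def]
  define s where "s v = z0 + S (inv_into M i v)" for v
  have si: "s (i k) = z0 + S k" if "k \<in> M" for k
    using that Mi by (simp add: s_def)
  have i0: "i 0 = I z0"
    by (simp add: i_def S0)
  show thesis
  proof (rule that[of "i ` M" s])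
    show "open (i ` M)" using Mi by blast
    show "I z0 \<in> i ` M" using M(2) i0 by force
    show "smooth_on (i ` M) s"
      unfolding s_def using Mi
      by (auto intro: smooth_on_add smooth_on_const smooth_on_bounded_linear[OF _ bounded_linear_slice])
    show "s ` i ` M \<subseteq> W"
      using M(3) si by (auto simp: Q_def)
    show "s (I z0) = z0"
      using si[OF M(2)] by (simp add: i0 S0)
    have "((\<lambda>z. snd (\<Psi> z)) \<longlongrightarrow> 0) (nhds z0)"
      using tendsto_snd[OF tendsto_\<Psi>[OF base_in_box filterlim_ident]] by (simp add: \<Psi>_base)
    then have "\<forall>\<^sub>F z in nhds z0. snd (\<Psi> z) \<in> M"
      by (rule topological_tendstoD[OF _ M(1,2)])
    with eventually_foot[OF inv] show "\<forall>\<^sub>F z in nhds z0. I z \<in> i ` M \<and> s (I z) = foot z"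
      by eventually_elim (use si in \<open>auto simp: foot_def i_def\<close>)
  qed
qed

end

text \<open>Smooth inverses for each fixed \<open>z\<close> say nothing yet about smoothness jointly
  in \<open>z\<close>. The map that keeps \<open>z\<close> as first component has a block triangular
  derivative with the identity and the injective fibre derivative on the diagonal.\<close>

lemma smoothly_invertible_on_fibrewise:
  fixes E :: "'a::euclidean_space \<times> 'b::euclidean_space \<Rightarrow> 'c::euclidean_space"
  assumes "open W" "open V" "smooth_on (W \<times> V) E" "DIM('b) = DIM('c)"
    and inv: "\<And>z. z \<in> W \<Longrightarrow> smoothly_invertible_on V (\<lambda>y. E (z, y))"
  shows "smoothly_invertible_on (W \<times> V) (\<lambda>p. (fst p, E p))"
proof (rule smoothly_invertible_onI)
  show WV: "open (W \<times> V)"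
    using assms by (simp add: open_Times)
  show sm: "smooth_on (W \<times> V) (\<lambda>p. (fst p, E p))"
    using WV assms(3) by (intro smooth_on_Pair smooth_on_fst smooth_on_ident)
  show "inj_on (\<lambda>p. (fst p, E p)) (W \<times> V)"
  proof (rule inj_onI)
    fix p q assume "p \<in> W \<times> V" "q \<in> W \<times> V" "(fst p, E p) = (fst q, E q)"
    then show "p = q"
      using inj_onD[of "\<lambda>y. E (fst p, y)" V "snd p" "snd q"] inv[of "fst p"]
      by (auto simp: smoothly_invertible_on_def)
  qed
  show "inj (frechet_derivative (\<lambda>p. (fst p, E p)) (at p))" if p: "p \<in> W \<times> V" for p
  proof -
    obtain z y where zy: "p = (z, y)" "z \<in> W" "y \<in> V"
      using p by blast
    let ?D = "frechet_derivative E (at p)"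
    note D = smooth_on_has_derivative[OF assms(3) p]
    have "((\<lambda>p. (fst p, E p)) has_derivative (\<lambda>h. (fst h, ?D h))) (at p)"
      by (intro has_derivative_Pair has_derivative_fst has_derivative_ident D)
    from frechet_derivative_at[OF this, symmetric]
    have eq: "frechet_derivative (\<lambda>p. (fst p, E p)) (at p) = (\<lambda>h. (fst h, ?D h))" .
    have "((\<lambda>y. (z, y)) has_derivative (\<lambda>h. (0, h))) (at y)"
      by (auto intro!: derivative_eq_intros)
    from diff_chain_at[OF this, of E ?D] D
    have "((\<lambda>y. E (z, y)) has_derivative (\<lambda>h. ?D (0, h))) (at y)"
      by (simp add: zy(1) o_def)
    from frechet_derivative_at[OF this] have "inj (\<lambda>h. ?D (0, h))"
      using smoothly_invertible_on_inj_derivative[OF inv[OF zy(2)] zy(3) assms(2)] by simp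
    then have inj0: "h = 0" if "?D (0, h) = 0" for h
      using that linear_0[OF has_derivative_linear[OF D]] injD[of "\<lambda>h. ?D (0, h)" h 0]
      by (simp add: zero_prod_def)
    have lin: "linear (\<lambda>h. (fst h, ?D h))"
      using smooth_on_has_derivative[OF sm p] has_derivative_linear eq by metis
    show ?thesis
      unfolding eq linear_injective_0[OF lin] using inj0 by (auto simp: zero_prod_def)
  qed
qed (use assms(4) in simp)

lemma smooth_on_Pair_right:
  assumes "smooth_on (W \<times> V) E" "open V" "open W" "z \<in> W"
  shows "smooth_on V (\<lambda>y. E (z, y))"
  by (rule smooth_on_compose[of V "W \<times> V"])
    (use assms in \<open>auto intro!: smooth_on_Pair smooth_on_const smooth_on_ident open_Times\<close>)

text \<open>Serves the two outputs \<open>y0\<close> and \<open>h z0\<close>, or two values of an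
  error, over a common first factor. The second factor is a union of two neighbourhoods, hence
  possibly disconnected.\<close>

lemma eventually_nhds_rectangle:
  assumes "\<forall>\<^sub>F p in nhds (z, y1). P p" "\<forall>\<^sub>F p in nhds (z, y2). P p"
  obtains W V where "open W" "z \<in> W" "open V" "y1 \<in> V" "y2 \<in> V" "\<And>p. p \<in> W \<times> V \<Longrightarrow> P p"
proof -
  have *: "\<exists>W V. open W \<and> z \<in> W \<and> open V \<and> y \<in> V \<and> (\<forall>p\<in>W \<times> V. P p)"
    if ev: "\<forall>\<^sub>F p in nhds (z, y). P p" for y
  proof -
    obtain Q where Q: "open Q" "(z, y) \<in> Q" "\<forall>p\<in>Q. P p"
      using ev by (auto simp: eventually_nhds)
    obtain W V where "open W" "open V" "(z, y) \<in> W \<times> V" "W \<times> V \<subseteq> Q"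
      by (rule open_prod_elim[OF Q(1,2)])
    with Q(3) show ?thesis
      by (intro exI[of _ W] exI[of _ V]) auto
  qed
  from *[OF assms(1)] *[OF assms(2)]
  obtain W1 V1 W2 V2 where
    "open W1" "z \<in> W1" "open V1" "y1 \<in> V1" "\<forall>p\<in>W1 \<times> V1. P p"
    "open W2" "z \<in> W2" "open V2" "y2 \<in> V2" "\<forall>p\<in>W2 \<times> V2. P p"
    by auto
  then show thesis
    by (intro that[of "W1 \<inter> W2" "V1 \<union> V2"]) auto
qed

section \<open>Invariant output errors\<close>

text \<open>
  The notion of an invariant output error for a single action \<open>\<tau>\<close> on the pairs \<open>z = (x, u)\<close>.
\<close>

definition output_error ::
    "('g::topological_group_add \<Rightarrow> 'a::euclidean_space \<Rightarrow> 'a) \<Rightarrow>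
     ('g \<Rightarrow> 'b::euclidean_space \<Rightarrow> 'b) \<Rightarrow> ('a \<Rightarrow> 'b) \<Rightarrow> 'a set \<Rightarrow> 'b set \<Rightarrow>
     ('a \<times> 'b \<Rightarrow> 'b) \<Rightarrow> bool" where
  "output_error \<tau> \<rho> h W V E \<longleftrightarrow>
     smooth_on (W \<times> V) E \<and>
     (\<forall>z\<in>W. smoothly_invertible_on V (\<lambda>y. E (z, y)) \<and> E (z, h z) = 0) \<and>
     (\<forall>z\<in>W. \<forall>y\<in>V. \<forall>\<^sub>F p in nhds (0, z, y).
        E (\<tau> (fst p) (fst (snd p)), \<rho> (fst p) (snd (snd p))) = E (snd p))"

lemma tendsto_nhds_Pair3:
  "((\<lambda>p. (fst p, fst (snd p))) \<longlongrightarrow> (a, b)) (nhds (a, b, c))"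
  "((\<lambda>p. (fst p, snd (snd p))) \<longlongrightarrow> (a, c)) (nhds (a, b, c))"
  using tendsto_nhds_Pair[where a = a and b = "(b, c)"]
  by (auto intro!: tendsto_Pair dest: tendsto_fst tendsto_snd)

lemma eventually_nhds_Pair3:
  assumes "\<forall>\<^sub>F p in nhds (a, b). P (fst p) (snd p)"
  shows "\<forall>\<^sub>F p in nhds (a, b, c). P (fst p) (fst (snd p))"
  using eventually_compose_filterlim[OF assms tendsto_nhds_Pair3(1)] by simp

lemma output_error_transform:
  fixes I :: "'a::euclidean_space \<Rightarrow> real^'k" and E :: "'a \<times> (real^'p) \<Rightarrow> real^'p"
  assumes E: "output_error \<tau> \<rho> h W V E" and "open W" "open V" and I: "smooth_on W I"
    and inv: "\<And>z. z \<in> W \<Longrightarrow> \<forall>\<^sub>F p in nhds (0, z). I (\<tau> (fst p) (snd p)) = I (snd p)"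
    and L: "error_transformation A B L"
    and AB: "\<And>z y. z \<in> W \<Longrightarrow> y \<in> V \<Longrightarrow> I z \<in> A \<and> E (z, y) \<in> B"
    and hV: "h ` W \<subseteq> V"
  shows "output_error \<tau> \<rho> h W V (\<lambda>p. L (I (fst p), E p))"
  unfolding output_error_def
proof (intro conjI ballI)
  note E = E[unfolded output_error_def] and L = L[unfolded error_transformation_def]
  have WV: "open (W \<times> V)"
    using assms by (simp add: open_Times)
  have sI: "smooth_on (W \<times> V) (\<lambda>p. I (fst p))"
    by (rule smooth_on_compose[OF WV \<open>open W\<close> _ smooth_on_fst[OF WV smooth_on_ident[OF WV]] I]) auto
  have "open (A \<times> B)"
    using L by (simp add: open_Times)
  then show "smooth_on (W \<times> V) (\<lambda>p. L (I (fst p), E p))"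
    by (rule smooth_on_compose[OF WV _ _ smooth_on_Pair[OF WV sI]]) (use L E AB in auto)
  fix z assume z: "z \<in> W"
  have "smoothly_invertible_on V (\<lambda>y. (\<lambda>e. L (I z, e)) (E (z, y)))"
  proof (rule smoothly_invertible_on_compose[where T = B and g = "\<lambda>e. L (I z, e)"])
    \<comment> \<open>The predicted output shows that \<open>V\<close> is nonempty, so that
      \<open>AB\<close> really places \<open>I z\<close> in \<open>A\<close>.\<close>
    have "h z \<in> V" using z hV by blast
    then show "smoothly_invertible_on B (\<lambda>e. L (I z, e))"
      using L AB z by blast
  qed (use E L z AB \<open>open V\<close> in auto)
  then show "smoothly_invertible_on V (\<lambda>y. L (I (fst (z, y)), E (z, y)))"
    by simp
  show "L (I (fst (z, h z)), E (z, h z)) = 0"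
    using E L z hV AB[OF z, of "h z"] by (simp add: image_subset_iff)
  fix y assume y: "y \<in> V"
  have "\<forall>\<^sub>F p in nhds (0, z, y).
      E (\<tau> (fst p) (fst (snd p)), \<rho> (fst p) (snd (snd p))) = E (snd p)"
    using E z y by blast
  with eventually_nhds_Pair3[OF inv[OF z]]
  show "\<forall>\<^sub>F p in nhds (0, z, y).
      L (I (fst (\<tau> (fst p) (fst (snd p)), \<rho> (fst p) (snd (snd p)))),
         E (\<tau> (fst p) (fst (snd p)), \<rho> (fst p) (snd (snd p)))) =
      L (I (fst (snd p)), E (snd p))"
    by eventually_elim simp
qed

text \<open>The action on outputs is read in the same chart, because the group element
  \<open>time z\<close> found on \<open>\<Sigma>\<close> is going to act on
  \<open>Y\<close>.\<close>

locale flow_box_output = flow_box \<A> C c \<Sigma> D \<tau> z0 S N + out: chart_action \<A> C c Y D\<^sub>\<rho> \<rho>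
  for \<A> :: "('g::{topological_group_add, t2_space, second_countable_topology}, 'r::finite) atlas"
    and C c and \<Sigma> :: "'a::euclidean_space set" and D \<tau> z0
    and S :: "real^'k::finite \<Rightarrow> 'a" and N
    and Y :: "(real^'p::finite) set" and D\<^sub>\<rho> \<rho> +
  fixes h :: "'a \<Rightarrow> real^'p"
  assumes lie: "lie_group \<A>" and smooth_h: "smooth_on \<Sigma> h" and h_range: "h ` \<Sigma> \<subseteq> Y"
begin

lemma tendsto_h: "z \<in> \<Sigma> \<Longrightarrow> (a \<longlongrightarrow> z) F \<Longrightarrow> ((\<lambda>x. h (a x)) \<longlongrightarrow> h z) F"
  using smooth_on_imp_continuous_on[OF smooth_h] open_action(1)
  by (metis continuous_on_eq_continuous_at isCont_tendsto_compose)

text \<open>Needed for the coordinates of \<open>- time z\<close> to depend smoothly on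
  \<open>z\<close>.\<close>

lemma smooth_inverse_chart:
  "open {s. s \<in> c ` C \<and> - \<gamma> s \<in> C}" "smooth_on {s. s \<in> c ` C \<and> - \<gamma> s \<in> C} (\<lambda>s. c (- \<gamma> s))"
proof -
  have "open (c ` C \<inter> (\<lambda>s. - \<gamma> s) -` C)"
    using chart_homeo open_chart
    by (intro continuous_open_preimage continuous_on_minus) (auto simp: homeomorphism_def)
  also have "c ` C \<inter> (\<lambda>s. - \<gamma> s) -` C = {s. s \<in> c ` C \<and> - \<gamma> s \<in> C}"
    by auto
  finally show "open {s. s \<in> c ` C \<and> - \<gamma> s \<in> C}" .
  show "smooth_on {s. s \<in> c ` C \<and> - \<gamma> s \<in> C} (\<lambda>s. c (- \<gamma> s))"
    using lie chart unfolding lie_group_def by fast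
qed

text \<open>
  The moving frame is \<open>z \<mapsto> - time z\<close>: transporting the outputs to the slice makes their difference
  invariant, because \<open>- time (\<tau> g z) = - time z - g\<close>.
\<close>

lemma output_error_exists:
  assumes equivariant: "\<And>z. z \<in> \<Sigma> \<Longrightarrow> \<forall>\<^sub>F p in nhds (0, z). h (\<tau> (fst p) (snd p)) = \<rho> (fst p) (h (snd p))"
    and y0: "y0 \<in> Y"
  obtains W V E where "open W" "z0 \<in> W" "W \<subseteq> \<Sigma>" "open V" "y0 \<in> V" "V \<subseteq> Y" "h ` W \<subseteq> V"
    "output_error \<tau> \<rho> h W V E"
proof -
  \<comment> \<open>An output has to be transported and transported back: the return trip is what
    makes \<open>\<rho> g\<close> invertible, with inverse \<open>\<rho> (- g)\<close>.\<close>
  define good where "good p \<longleftrightarrow> p \<in> D\<^sub>\<rho> \<and> (- fst p, \<rho> (fst p) (snd p)) \<in> D\<^sub>\<rho>" for p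
  have good: "\<forall>\<^sub>F p in nhds (0, y). good p" if y: "y \<in> Y" for y
  proof -
    have "((\<lambda>p. \<rho> (fst p) (snd p)) \<longlongrightarrow> \<rho> 0 y) (nhds (0, y))"
      by (rule out.tendsto_action[OF tendsto_nhds_Pair zero_in_chart out.zero_in_dom[OF y]])
    from tendsto_Pair[OF tendsto_minus[OF tendsto_nhds_Pair(1)[of 0 y]] this]
    have "((\<lambda>p. (- fst p, \<rho> (fst p) (snd p))) \<longlongrightarrow> (0, y)) (nhds (0, y))"
      using out.action_zero[OF y] by simp
    from topological_tendstoD[OF this out.open_action(2) out.zero_in_dom[OF y]]
      eventually_nhds_in_open[OF out.open_action(2) out.zero_in_dom[OF y]]
    show ?thesis
      by eventually_elim (simp add: good_def)
  qed
  have hz0: "h z0 \<in> Y"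
    using base h_range by blast
  obtain G V where G: "open G" "0 \<in> G" and V: "open V" "y0 \<in> V" "h z0 \<in> V"
    and GV: "\<And>p. p \<in> G \<times> V \<Longrightarrow> good p"
    by (rule eventually_nhds_rectangle[OF good[OF y0] good[OF hz0]]) blast
  have VY: "V \<subseteq> Y"
    using GV[of "(0, y)" for y] G(2) out.dom_subset by (auto simp: good_def)
  have time0: "((\<lambda>z. - time z) \<longlongrightarrow> 0) (nhds z0)"
    using tendsto_minus[OF tendsto_time[OF base_in_box filterlim_ident]] by (simp add: time_base)
  have "\<forall>\<^sub>F z in nhds z0. z \<in> box \<and> - time z \<in> C \<and> - time z \<in> G \<and> h z \<in> V"
    using eventually_box topological_tendstoD[OF time0 open_chart(1) zero_in_chart]
      topological_tendstoD[OF time0 G] topological_tendstoD[OF tendsto_h[OF base filterlim_ident] V(1,3)]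
    by eventually_elim blast
  then obtain W where W: "open W" "z0 \<in> W"
    and W_box: "\<And>z. z \<in> W \<Longrightarrow> z \<in> box" and W_C: "\<And>z. z \<in> W \<Longrightarrow> - time z \<in> C"
    and W_G: "\<And>z. z \<in> W \<Longrightarrow> - time z \<in> G" and hWV: "h ` W \<subseteq> V"
    unfolding eventually_nhds by blast
  have W\<Sigma>: "W \<subseteq> \<Sigma>"
    using W_box box_subset by blast
  have dom: "(- time z, y) \<in> D\<^sub>\<rho>" "(time z, \<rho> (- time z) y) \<in> D\<^sub>\<rho>" if "z \<in> W" "y \<in> V" for z y
    using GV[of "(- time z, y)"] W_G that by (auto simp: good_def)
  define E where "E p = \<rho> (- time (fst p)) (snd p) - \<rho> (- time (fst p)) (h (fst p))" for p
  have WV: "open (W \<times> V)"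
    using W V by (simp add: open_Times)
  define n where "n z = c (- \<gamma> (fst (\<Psi> z)))" for z
  have n: "\<gamma> (n z) = - time z" "n z \<in> c ` C" if "z \<in> W" for z
    using W_C[OF that] by (auto simp: n_def time_def chart_inverse)
  have "smooth_on W n"
    unfolding n_def
    by (rule smooth_on_compose[OF W(1) smooth_inverse_chart(1) _ _ smooth_inverse_chart(2)])
      (use W_box W_C time_in_chart(2) in \<open>auto simp: time_def intro: smooth_on_fst[OF W(1)]
        smooth_on_subset[OF smooth_\<Psi>]\<close>)
  note fst_WV = smooth_on_fst[OF WV smooth_on_ident[OF WV]]
  have n_fst: "smooth_on (W \<times> V) (\<lambda>p. n (fst p))"
    by (rule smooth_on_compose[OF WV W(1) _ fst_WV \<open>smooth_on W n\<close>]) auto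
  have h_fst: "smooth_on (W \<times> V) (\<lambda>p. h (fst p))"
    by (rule smooth_on_compose[OF WV W(1) _ fst_WV smooth_on_subset[OF smooth_h W\<Sigma>]]) auto
  have sm: "smooth_on (W \<times> V) E"
  proof (rule smooth_on_cong[OF WV _ smooth_on_diff[OF WV]])
    show "smooth_on (W \<times> V) (\<lambda>p. \<rho> (\<gamma> (n (fst p))) (snd p))"
      by (rule out.smooth_on_action[OF WV n_fst smooth_on_snd[OF WV smooth_on_ident[OF WV]]])
        (use n dom in auto)
    show "smooth_on (W \<times> V) (\<lambda>p. \<rho> (\<gamma> (n (fst p))) (h (fst p)))"
      by (rule out.smooth_on_action[OF WV n_fst h_fst]) (use n dom hWV in auto)
  qed (use n in \<open>auto simp: E_def\<close>)
  have invertible: "smoothly_invertible_on V (\<lambda>y. E (z, y))" if z: "z \<in> W" for z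
  proof -
    \<comment> \<open>Solving \<open>E (z, y) = e\<close> for \<open>y\<close> gives the explicit
      inverse that adds the transported prediction and transports back by \<open>time z\<close>;
      \<open>T\<close> is its natural domain.\<close>
    define T where "T = (\<lambda>e. (time z, e + \<rho> (- time z) (h z))) -` D\<^sub>\<rho>"
    have T: "open T"
      unfolding T_def by (intro open_vimage out.open_action continuous_intros)
    show ?thesis
    proof (rule smoothly_invertible_on_left_inverse[OF V(1) smooth_on_Pair_right[OF sm V(1) W(1) z] T])
      show "smooth_on T (\<lambda>e. \<rho> (\<gamma> (fst (\<Psi> z))) (e + \<rho> (- time z) (h z)))"
        by (rule out.smooth_on_action[OF T smooth_on_const[OF T]
              smooth_on_add[OF T smooth_on_ident[OF T] smooth_on_const[OF T]]])
          (use time_in_chart[OF W_box[OF z]] in \<open>auto simp: T_def time_def\<close>)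
      show "(\<lambda>y. E (z, y)) ` V \<subseteq> T"
        using dom[OF z] by (auto simp: E_def T_def)
      show "\<rho> (\<gamma> (fst (\<Psi> z))) (E (z, y) + \<rho> (- time z) (h z)) = y" if "y \<in> V" for y
        using out.action_inverse[of "- time z" y] dom[OF z that] by (simp add: E_def time_def)
    qed simp
  qed
  have frame: "\<forall>\<^sub>F p in nhds (0, z, y). \<rho> (- time (\<tau> (fst p) (fst (snd p)))) (\<rho> (fst p) (snd (snd p))) =
      \<rho> (- time (fst (snd p))) (snd (snd p))" if z: "z \<in> W" and y: "y \<in> V" for z y
  proof -
    let ?F = "nhds (0 :: 'g, z, y)"
    have yY: "y \<in> Y"
      using y VY by blast
    note p = tendsto_nhds_Pair(1)[where a = 0 and b = "(z, y)"] tendsto_fst[OF tendsto_nhds_Pair(2)[where a = 0 and b = "(z, y)"], simplified]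
      tendsto_snd[OF tendsto_nhds_Pair(2)[where a = 0 and b = "(z, y)"], simplified]
    note t = tendsto_time[OF W_box[OF z] p(2)]
    have 1: "\<forall>\<^sub>F p in ?F. (fst p, snd (snd p)) \<in> D\<^sub>\<rho>"
      using topological_tendstoD[OF tendsto_Pair[OF p(1,3)] out.open_action(2) out.zero_in_dom[OF yY]] .
    have 2: "\<forall>\<^sub>F p in ?F. (- time (fst (snd p)), snd (snd p)) \<in> D\<^sub>\<rho>"
      using topological_tendstoD[OF tendsto_Pair[OF tendsto_minus[OF t] p(3)] out.open_action(2) dom(1)[OF z y]] .
    have "((\<lambda>p. (- (fst p + time (fst (snd p))), \<rho> (fst p) (snd (snd p)))) \<longlongrightarrow> (- (0 + time z), \<rho> 0 y)) ?F"
      by (rule tendsto_Pair[OF tendsto_minus[OF tendsto_add[OF p(1) t]]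
            out.tendsto_action[OF p(1,3) zero_in_chart out.zero_in_dom[OF yY]]])
    from topological_tendstoD[OF this out.open_action(2)]
    have 3: "\<forall>\<^sub>F p in ?F. (- (fst p + time (fst (snd p))), \<rho> (fst p) (snd (snd p))) \<in> D\<^sub>\<rho>"
      using dom(1)[OF z y] out.action_zero[OF yY] by simp
    from eventually_nhds_Pair3[OF box_equivariant[OF W_box[OF z]]] 1 2 3
    show ?thesis
    proof eventually_elim
      case (elim p)
      let ?g = "fst p" and ?t = "time (fst (snd p))"
      \<comment> \<open>In a noncommutative group \<open>minus_add\<close> reverses the order,
        \<open>- (g + t) = - t + - g\<close>, which is exactly what lets \<open>g\<close> cancel on
        the right.\<close>
      have "- (?g + ?t) + ?g = - ?t"
        by (simp add: minus_add add.assoc)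
      then show ?case
        using out.action_add[OF elim(2,4)] elim(1,3) by simp
    qed
  qed
  have equiv: "\<forall>\<^sub>F p in nhds (0, z, y).
      E (\<tau> (fst p) (fst (snd p)), \<rho> (fst p) (snd (snd p))) = E (snd p)" if z: "z \<in> W" and y: "y \<in> V" for z y
  proof -
    have z\<Sigma>: "z \<in> \<Sigma>" and hz: "h z \<in> V"
      using z W\<Sigma> hWV by blast+
    \<comment> \<open>The prediction term is the case \<open>y = h z\<close> of
      \<open>frame\<close>; equivariance of \<open>h\<close> turns \<open>\<rho> g (h z)\<close>
      into the prediction at the moved point.\<close>
    have "((\<lambda>p. (fst p, snd p, h (snd p))) \<longlongrightarrow> (0, z, h z)) (nhds (0, z))"
      by (intro tendsto_Pair tendsto_nhds_Pair tendsto_h[OF z\<Sigma>])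
    from eventually_compose_filterlim[OF frame[OF z hz] this]
    have "\<forall>\<^sub>F p in nhds (0, z). \<rho> (- time (\<tau> (fst p) (snd p))) (\<rho> (fst p) (h (snd p))) =
      \<rho> (- time (snd p)) (h (snd p))" by simp
    from eventually_nhds_Pair3[OF this] eventually_nhds_Pair3[OF equivariant[OF z\<Sigma>]] frame[OF z y]
    show ?thesis
      by eventually_elim (simp add: E_def)
  qed
  show thesis
    using W W\<Sigma> V VY hWV sm invertible equiv
    by (intro that[of W V E]) (auto simp: output_error_def E_def)
qed

text \<open>The counterpart of \<open>eventually_foot\<close>: invariance at
  \<open>(0, z0, y)\<close> is used with the group element \<open>time z\<close> acting on the slice
  point and on the output already transported to the slice.\<close>

lemma output_error_foot:
  assumes E: "output_error \<tau> \<rho> h W V E" and "z0 \<in> W" "y \<in> V" "y \<in> Y"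
  shows "\<forall>\<^sub>F p in nhds (z0, y). E p = E (foot (fst p), \<rho> (- time (fst p)) (snd p))"
proof -
  let ?F = "nhds (z0, y)"
  note p = tendsto_nhds_Pair[where a = z0 and b = y]
  have t: "((\<lambda>p. time (fst p)) \<longlongrightarrow> 0) ?F" and f: "((\<lambda>p. foot (fst p)) \<longlongrightarrow> z0) ?F"
    using tendsto_time[OF base_in_box p(1)] tendsto_foot[OF base_in_box p(1)]
    by (simp_all add: time_base foot_base)
  have mt: "((\<lambda>p. - time (fst p)) \<longlongrightarrow> 0) ?F"
    using tendsto_minus[OF t] by simp
  have r: "((\<lambda>p. \<rho> (- time (fst p)) (snd p)) \<longlongrightarrow> y) ?F"
    using out.tendsto_action[OF mt p(2) zero_in_chart out.zero_in_dom[OF assms(4)]]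
    by (simp add: out.action_zero[OF assms(4)])
  have "\<forall>\<^sub>F p in nhds (0, z0, y).
      E (\<tau> (fst p) (fst (snd p)), \<rho> (fst p) (snd (snd p))) = E (snd p)"
    using E assms(2,3) unfolding output_error_def by blast
  from eventually_compose_filterlim[OF this tendsto_Pair[OF t tendsto_Pair[OF f r]]]
  have "\<forall>\<^sub>F p in ?F. E (\<tau> (time (fst p)) (foot (fst p)), \<rho> (time (fst p)) (\<rho> (- time (fst p)) (snd p))) =
      E (foot (fst p), \<rho> (- time (fst p)) (snd p))"
    by simp
  moreover have "\<forall>\<^sub>F p in ?F. fst p \<in> box"
    using topological_tendstoD[OF p(1) open_box base_in_box] .
  moreover have "\<forall>\<^sub>F p in ?F. (- time (fst p), snd p) \<in> D\<^sub>\<rho>"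
    using topological_tendstoD[OF tendsto_Pair[OF mt p(2)] out.open_action(2) out.zero_in_dom[OF assms(4)]] .
  moreover have "\<forall>\<^sub>F p in ?F. (time (fst p), \<rho> (- time (fst p)) (snd p)) \<in> D\<^sub>\<rho>"
    using topological_tendstoD[OF tendsto_Pair[OF t r] out.open_action(2) out.zero_in_dom[OF assms(4)]] .
  ultimately show ?thesis
  proof eventually_elim
    case (elim p)
    then show ?case
      using out.action_inverse[of "- time (fst p)" "snd p"] by (simp add: time_foot)
  qed
qed

lemma tendsto_output_foot:
  assumes "y \<in> Y"
  shows "((\<lambda>p. \<rho> (- time (fst p)) (snd p)) \<longlongrightarrow> y) (nhds (z0, y))"
proof -
  have "((\<lambda>p. - time (fst p)) \<longlongrightarrow> 0) (nhds (z0, y))"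
    using tendsto_minus[OF tendsto_time[OF base_in_box tendsto_nhds_Pair(1)]] by (simp add: time_base)
  from out.tendsto_action[OF this tendsto_nhds_Pair(2) zero_in_chart out.zero_in_dom[OF assms]]
  show ?thesis
    by (simp add: out.action_zero[OF assms])
qed

text \<open>
  On the slice, \<open>E'\<close> is a function of \<open>E\<close> since \<open>E (z, _)\<close> is invertible, and the points of the slice
  are functions of \<open>I\<close>. Both errors are determined by their values on the slice.
\<close>

lemma output_error_factors:
  fixes I :: "'a \<Rightarrow> real^'k"
  assumes E: "output_error \<tau> \<rho> h W V E" and E': "output_error \<tau> \<rho> h W V E'"
    and W: "open W" "z0 \<in> W" "W \<subseteq> \<Sigma>" and V: "open V" "y0 \<in> V" "V \<subseteq> Y" and hWV: "h ` W \<subseteq> V"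
    and I: "smooth_on W I" "\<forall>\<^sub>F p in nhds (0, z0). I (\<tau> (fst p) (snd p)) = I (snd p)"
      "dim (range (frechet_derivative I (at z0))) = CARD('k)"
  obtains W' V' A B L where "open W'" "z0 \<in> W'" "W' \<subseteq> W" "open V'" "y0 \<in> V'" "V' \<subseteq> V" "h ` W' \<subseteq> V'"
    "error_transformation A B L"
    "\<And>z y. z \<in> W' \<Longrightarrow> y \<in> V' \<Longrightarrow> I z \<in> A \<and> E (z, y) \<in> B \<and> E' (z, y) = L (I z, E (z, y))"
proof -
  note E_def = E[unfolded output_error_def] and E'_def = E'[unfolded output_error_def]
  have WV: "open (W \<times> V)"
    using W V by (simp add: open_Times)
  \<comment> \<open>Keeping \<open>z\<close> alongside the error makes the inverse jointly smooth;
    its second component \<open>K (z, e)\<close> is the output at which the error \<open>E\<close>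
    takes the value \<open>e\<close>.\<close>
  define G where "G p = (fst p, E p)" for p
  have G: "smoothly_invertible_on (W \<times> V) G"
    unfolding G_def using E_def W V by (intro smoothly_invertible_on_fibrewise) auto
  define Q where "Q = G ` (W \<times> V)"
  define K where "K = (\<lambda>q. snd (inv_into (W \<times> V) G q))"
  have Q: "open Q" and smK: "smooth_on Q K"
    using G smooth_on_snd by (auto simp: smoothly_invertible_on_def Q_def K_def)
  have K: "K (z, E (z, y)) = y" "(z, E (z, y)) \<in> Q" if "z \<in> W" "y \<in> V" for z y
  proof -
    have "inv_into (W \<times> V) G (G (z, y)) = (z, y)"
      using G that by (intro inv_into_f_f) (auto simp: smoothly_invertible_on_def)
    then show "K (z, E (z, y)) = y"
      by (simp add: K_def G_def)
    show "(z, E (z, y)) \<in> Q"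
      using that unfolding Q_def G_def by force
  qed
  have KV: "z \<in> W" "K (z, e) \<in> V" "E (z, K (z, e)) = e" if q: "(z, e) \<in> Q" for z e
  proof -
    obtain z' y where "z' \<in> W" "y \<in> V" "(z, e) = (z', E (z', y))"
      using q unfolding Q_def G_def by auto
    then show "z \<in> W" "K (z, e) \<in> V" "E (z, K (z, e)) = e"
      using K by auto
  qed
  obtain A0 s where A0: "open A0" "I z0 \<in> A0" and s: "smooth_on A0 s" "s ` A0 \<subseteq> W" "s (I z0) = z0"
    and sI: "\<forall>\<^sub>F z in nhds z0. I z \<in> A0 \<and> s (I z) = foot z"
    by (rule invariant_section[OF W(1,2) I])
  have hz0: "h z0 \<in> V"
    using W hWV by blast
  have near: "\<forall>\<^sub>F q in nhds (I z0, E (z0, y)). fst q \<in> A0 \<and> (s (fst q), snd q) \<in> Q" if y: "y \<in> V" for y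
  proof -
    let ?F = "nhds (I z0, E (z0, y))"
    have "isCont s (I z0)"
      using smooth_on_imp_continuous_on[OF s(1)] A0 continuous_on_eq_continuous_at by blast
    from isCont_tendsto_compose[OF this tendsto_nhds_Pair(1)]
    have "((\<lambda>q. (s (fst q), snd q)) \<longlongrightarrow> (z0, E (z0, y))) ?F"
      by (intro tendsto_Pair tendsto_nhds_Pair) (simp add: s(3))
    from topological_tendstoD[OF this Q K(2)[OF W(2) y]] topological_tendstoD[OF tendsto_nhds_Pair(1) A0]
    show ?thesis
      by eventually_elim blast
  qed
  \<comment> \<open>The second value \<open>E (z0, h z0)\<close> is 0, so \<open>B\<close> contains
    0 as an error transformation requires, even when \<open>E (z0, y0)\<close> is far from
    0.\<close>
  obtain A B where A: "open A" "I z0 \<in> A" and B: "open B" "E (z0, y0) \<in> B" "E (z0, h z0) \<in> B"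
    and AB: "\<And>q. q \<in> A \<times> B \<Longrightarrow> fst q \<in> A0 \<and> (s (fst q), snd q) \<in> Q"
    by (rule eventually_nhds_rectangle[OF near[OF V(2)] near[OF hz0]]) blast
  \<comment> \<open>To evaluate \<open>L\<close> at \<open>(v, e)\<close>, go to the slice point
    \<open>s v\<close> with invariant value \<open>v\<close>, find the output with
    \<open>E\<close>-error \<open>e\<close> there, and read off its \<open>E'\<close>-error.\<close>
  define L where "L q = E' (s (fst q), K (s (fst q), snd q))" for q
  have AxB: "open (A \<times> B)"
    using A B by (simp add: open_Times)
  have s_fst: "smooth_on (A \<times> B) (\<lambda>q. s (fst q))"
    by (rule smooth_on_compose[OF AxB A0(1) _ smooth_on_fst[OF AxB smooth_on_ident[OF AxB]] s(1)])
      (use AB in auto)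
  have K_AB: "smooth_on (A \<times> B) (\<lambda>q. K (s (fst q), snd q))"
    by (rule smooth_on_compose[OF AxB Q _
          smooth_on_Pair[OF AxB s_fst smooth_on_snd[OF AxB smooth_on_ident[OF AxB]]] smK])
      (use AB in auto)
  have smL: "smooth_on (A \<times> B) L"
    unfolding L_def
    by (rule smooth_on_compose[OF AxB WV _ smooth_on_Pair[OF AxB s_fst K_AB]])
      (use AB KV E'_def in auto)
  have B0: "0 \<in> B"
    using B(3) E_def W(2) by auto
  have L: "error_transformation A B L"
    unfolding error_transformation_def
  proof (intro conjI ballI)
    fix v assume v: "v \<in> A"
    have sv: "s v \<in> W"
      using AB[of "(v, 0)"] v B0 s(2) by auto
    have "h (s v) \<in> V"
      using sv hWV by blast
    then have "K (s v, 0) = h (s v)"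
      using K(1)[OF sv, of "h (s v)"] E_def sv by simp
    then show "L (v, 0) = 0"
      using E'_def sv by (simp add: L_def)
    have "smoothly_invertible_on B (\<lambda>e. K (s v, e))"
      by (rule smoothly_invertible_on_left_inverse[OF B(1) smooth_on_Pair_right[OF K_AB B(1) A(1) v, simplified]
            V(1) smooth_on_Pair_right[of W V E, OF _ V(1) W(1) sv]])
        (use E_def AB v KV in auto)
    then have "smoothly_invertible_on B (\<lambda>e. (\<lambda>y. E' (s v, y)) (K (s v, e)))"
      by (rule smoothly_invertible_on_compose[OF _ _ B(1) V(1)]) (use E'_def sv AB v KV in auto)
    then show "smoothly_invertible_on B (\<lambda>e. L (v, e))"
      by (simp add: L_def)
  qed (use A B B0 smL in auto)
  define P where "P p \<longleftrightarrow> fst p \<in> W \<and> snd p \<in> V \<and> I (fst p) \<in> A \<and> E p \<in> B \<and> E' p = L (I (fst p), E p)" for p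
  have P: "\<forall>\<^sub>F p in nhds (z0, y). P p" if y: "y \<in> V" "E (z0, y) \<in> B" for y
  proof -
    let ?F = "nhds (z0, y)"
    have yY: "y \<in> Y"
      using y V by blast
    have zy: "(z0, y) \<in> W \<times> V"
      using W y by blast
    note p = tendsto_nhds_Pair[where a = z0 and b = y]
    have "isCont E (z0, y)" "isCont I z0"
      using smooth_on_imp_continuous_on[of "W \<times> V" E] smooth_on_imp_continuous_on[OF I(1)] E_def
        continuous_on_eq_continuous_at WV W(1,2) zy by blast+
    then have "(E \<longlongrightarrow> E (z0, y)) ?F" "((\<lambda>p. I (fst p)) \<longlongrightarrow> I z0) ?F"
      using isCont_tendsto_compose[OF _ filterlim_ident] isCont_tendsto_compose[OF _ p(1)] by blast+
    note ev = topological_tendstoD[OF this(1) B(1) y(2)] topological_tendstoD[OF this(2) A]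
      topological_tendstoD[OF p(1) W(1,2)] topological_tendstoD[OF p(2) V(1) y(1)]
      topological_tendstoD[OF tendsto_output_foot[OF yY] V(1) y(1)]
      output_error_foot[OF E W(2) y(1) yY] output_error_foot[OF E' W(2) y(1) yY]
      eventually_compose_filterlim[OF sI p(1)]
    from ev show ?thesis
    proof eventually_elim
      case (elim p)
      \<comment> \<open>The values of \<open>I\<close>, \<open>E\<close> and \<open>E'\<close> at
        \<open>p\<close> are those at this slice point and transported output, where
        \<open>K\<close> undoes \<open>E\<close>.\<close>
      let ?z = "foot (fst p)" and ?y = "\<rho> (- time (fst p)) (snd p)"
      have "?z \<in> W"
        using elim(8) s(2) by auto
      have "L (I (fst p), E p) = E' (?z, K (?z, E (?z, ?y)))"
        using elim(6,8) by (simp add: L_def)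
      also have "\<dots> = E' p"
        using K(1)[OF \<open>?z \<in> W\<close> elim(5)] elim(7) by simp
      finally show ?case
        using elim by (simp add: P_def)
    qed
  qed
  obtain W1 V' where W1: "open W1" "z0 \<in> W1" and V': "open V'" "y0 \<in> V'" "h z0 \<in> V'"
    and PP: "\<And>p. p \<in> W1 \<times> V' \<Longrightarrow> P p"
    by (rule eventually_nhds_rectangle[OF P[OF V(2) B(2)] P[OF hz0 B(3)]]) blast
  \<comment> \<open>Shrinking \<open>W1\<close> once more keeps the predictions inside the smaller
    output set, so the new sets still form a local domain.\<close>
  have "\<forall>\<^sub>F z in nhds z0. z \<in> W1 \<and> h z \<in> V'"
    using eventually_nhds_in_open[OF W1] topological_tendstoD[OF tendsto_h[OF base filterlim_ident] V'(1,3)]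
    by eventually_elim blast
  then obtain W' where W': "open W'" "z0 \<in> W'" "\<And>z. z \<in> W' \<Longrightarrow> z \<in> W1 \<and> h z \<in> V'"
    unfolding eventually_nhds by blast
  show thesis
  proof (rule that[OF W'(1,2) _ V'(1,2) _ _ L])
    show "W' \<subseteq> W" "V' \<subseteq> V" "h ` W' \<subseteq> V'"
      using PP W' W1(2) V'(2) by (fastforce simp: P_def)+
    show "I z \<in> A \<and> E (z, y) \<in> B \<and> E' (z, y) = L (I z, E (z, y))" if "z \<in> W'" "y \<in> V'" for z y
      using PP[of "(z, y)"] W'(3) that by (simp add: P_def)
  qed
qed

end

section \<open>The product action and the return to separate state and input\<close>

lemma linear_full_rank_imp_inj:
  fixes f :: "'a::euclidean_space \<Rightarrow> 'b::euclidean_space"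
  assumes "linear f" "dim (range f) = DIM('a)"
  shows "inj f"
proof -
  obtain g :: "'b \<Rightarrow> 'a" where g: "linear g" "g ` range f = UNIV"
    using subspace_isomorphism[OF linear_subspace_image[OF assms(1) subspace_UNIV], of "UNIV :: 'a set"]
      assms(2) by auto
  have "inj (g \<circ> f)"
    using linear_surjective_imp_injective[OF linear_compose[OF assms(1) g(1)]] g(2)
    by (simp add: image_comp)
  then show ?thesis
    by (rule inj_on_imageI2)
qed

text \<open>The rank condition concerns the state alone. It suffices because the state component of
  the derivative of the orbit map of \<open>(x, u)\<close> is already injective.\<close>

lemma flow_box_exists_product:
  assumes "smooth_atlas \<A>" "(C, c) \<in> \<A>" "0 \<in> C"
    and \<phi>: "local_transformation_group \<A> X D\<^sub>\<phi> \<phi>" and \<psi>: "local_transformation_group \<A> U D\<^sub>\<psi> \<psi>"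
    and rank: "full_rank_action \<A> X \<phi>" and x: "x \<in> X" and u: "u \<in> U"
    and dim: "CARD('r) \<le> CARD('n)" "CARD('k) = CARD('n) + CARD('m) - CARD('r)"
  obtains S :: "real^'k::finite \<Rightarrow> (real^'n) \<times> (real^'m)" and N
  where "flow_box (\<A> :: ('g::{topological_group_add, t2_space, second_countable_topology}, 'r::finite) atlas)
      C c (X \<times> U) {(g, x, u). (g, x) \<in> D\<^sub>\<phi> \<and> (g, u) \<in> D\<^sub>\<psi>} (\<lambda>g (x, u). (\<phi> g x, \<psi> g u)) (x, u) S N"
proof -
  interpret state: chart_action \<A> C c X D\<^sub>\<phi> \<phi>
    using assms by unfold_locales
  interpret input: chart_action \<A> C c U D\<^sub>\<psi> \<psi>
    using assms by unfold_locales
  interpret chart_action \<A> C c "X \<times> U" "{(g, x, u). (g, x) \<in> D\<^sub>\<phi> \<and> (g, u) \<in> D\<^sub>\<psi>}"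
      "\<lambda>g (x, u). (\<phi> g x, \<psi> g u)"
    using assms(1-3) local_transformation_group_product[OF assms(1) \<phi> \<psi>] by unfold_locales
  let ?A = "frechet_derivative (\<lambda>t. \<phi> (\<gamma> t) x) (at (c 0))"
  let ?B = "frechet_derivative (\<lambda>t. \<psi> (\<gamma> t) u) (at (c 0))"
  note A = state.orbit_has_derivative[OF x]
  \<comment> \<open>A property holding near the identity is evaluated at the identity
    itself.\<close>
  have "\<forall>(C, c)\<in>\<A>. 0 \<in> C \<longrightarrow>
      dim (range (frechet_derivative (\<lambda>t. \<phi> (inv_into C c t) x) (at (c 0)))) = CARD('r)"
    using rank x eventually_nhds_x_imp_x unfolding full_rank_action_def by fast
  then have "dim (range ?A) = CARD('r)"
    using assms(2,3) by blast
  then have inj: "inj ?A"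
    by (intro linear_full_rank_imp_inj has_derivative_linear[OF A]) simp
  have "((\<lambda>t. (\<phi> (\<gamma> t) x, \<psi> (\<gamma> t) u)) has_derivative (\<lambda>h. (?A h, ?B h))) (at (c 0))"
    by (intro has_derivative_Pair A input.orbit_has_derivative[OF u])
  from frechet_derivative_at[OF this, symmetric]
  have inj': "inj (frechet_derivative (\<lambda>t. (\<lambda>(x, u). (\<phi> (\<gamma> t) x, \<psi> (\<gamma> t) u)) (x, u)) (at (c 0)))"
    using inj by (simp add: inj_on_def)
  have xu: "(x, u) \<in> X \<times> U"
    using x u by blast
  \<comment> \<open>The subtraction of naturals in \<open>dim(2)\<close> is exact by
    \<open>dim(1)\<close>.\<close>
  have dim': "CARD('r) + CARD('k) = DIM((real^'n) \<times> (real^'m))"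
    using dim by simp
  obtain S :: "real^'k \<Rightarrow> (real^'n) \<times> (real^'m)" and N
    where "linear S" "open N" "(c 0, 0) \<in> N" "(\<lambda>(t, k). (t, (x, u) + S k)) ` N \<subseteq> dom"
      "smoothly_invertible_on N (\<lambda>(t, k). (\<lambda>(x, u). (\<phi> (\<gamma> t) x, \<psi> (\<gamma> t) u)) ((x, u) + S k))"
    by (rule flow_box_exists[OF xu inj' dim'])
  then show thesis
    using xu by (intro that[of S N] flow_box.intro flow_box_axioms.intro chart_action_axioms)
qed

text \<open>Passes between triples \<open>(x, u, y)\<close>, nested to the right, and pairs
  \<open>((x, u), y)\<close> whose first component is one point of the product action.\<close>

lemma smooth_on_assoc:
  fixes E :: "'a::euclidean_space \<times> 'b::euclidean_space \<times> 'c::euclidean_space \<Rightarrow> 'd::real_normed_vector"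
  assumes "open W" "open V"
  shows "smooth_on {(x, u, y). (x, u) \<in> W \<and> y \<in> V} E \<longleftrightarrow>
    smooth_on (W \<times> V) (\<lambda>(z, y). E (fst z, snd z, y))"
    (is "smooth_on ?S E \<longleftrightarrow> smooth_on _ ?E")
proof -
  have WV: "open (W \<times> V)"
    using assms by (simp add: open_Times)
  have "open ((\<lambda>p. ((fst p, fst (snd p)), snd (snd p))) -` (W \<times> V))"
    using WV by (intro open_vimage continuous_intros)
  also have "(\<lambda>p. ((fst p, fst (snd p)), snd (snd p))) -` (W \<times> V) = ?S"
    by auto
  finally have S: "open ?S" .
  have 1: "smooth_on (W \<times> V) (\<lambda>p. (fst (fst p), snd (fst p), snd p))"
    by (intro smooth_on_Pair smooth_on_fst smooth_on_snd smooth_on_ident WV)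
  have 2: "smooth_on ?S (\<lambda>p. ((fst p, fst (snd p)), snd (snd p)))"
    by (intro smooth_on_Pair smooth_on_fst smooth_on_snd smooth_on_ident S)
  have 3: "(\<lambda>p. (fst (fst p), snd (fst p), snd p)) ` (W \<times> V) \<subseteq> ?S"
    "(\<lambda>p. ((fst p, fst (snd p)), snd (snd p))) ` ?S \<subseteq> W \<times> V"
    by auto
  show ?thesis
  proof
    assume "smooth_on ?S E"
    from smooth_on_compose[OF WV S 3(1) 1 this] show "smooth_on (W \<times> V) ?E"
      by (simp add: case_prod_unfold)
  next
    assume "smooth_on (W \<times> V) ?E"
    from smooth_on_compose[OF S WV 3(2) 2 this] show "smooth_on ?S E"
      by (simp add: case_prod_unfold)
  qed
qed

lemma eventually_nhds_assoc:
  fixes a :: "'a::t2_space" and x :: "'b::t2_space" and u :: "'c::t2_space" and y :: "'d::t2_space"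
  shows
  "(\<forall>\<^sub>F p in nhds (a, (x, u), y). P (fst p) (fst (fst (snd p))) (snd (fst (snd p))) (snd (snd p))) \<longleftrightarrow>
   (\<forall>\<^sub>F p in nhds (a, x, u, y). P (fst p) (fst (snd p)) (fst (snd (snd p))) (snd (snd (snd p))))"
  (is "?l \<longleftrightarrow> ?r")
proof
  assume l: ?l
  have "isCont (\<lambda>p. (fst p, (fst (snd p), fst (snd (snd p))), snd (snd (snd p)))) (a, x, u, y)"
    by (intro continuous_intros)
  from isCont_tendsto_compose[OF this filterlim_ident]
  have "((\<lambda>p. (fst p, (fst (snd p), fst (snd (snd p))), snd (snd (snd p)))) \<longlongrightarrow> (a, (x, u), y))
      (nhds (a, x, u, y))"
    by simp
  from eventually_compose_filterlim[OF l this] show ?r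
    by simp
next
  assume r: ?r
  have "isCont (\<lambda>p. (fst p, fst (fst (snd p)), snd (fst (snd p)), snd (snd p))) (a, (x, u), y)"
    by (intro continuous_intros)
  from isCont_tendsto_compose[OF this filterlim_ident]
  have "((\<lambda>p. (fst p, fst (fst (snd p)), snd (fst (snd p)), snd (snd p))) \<longlongrightarrow> (a, x, u, y))
      (nhds (a, (x, u), y))"
    by simp
  from eventually_compose_filterlim[OF r this] show ?l
    by simp
qed

lemma invariant_function_iff:
  "invariant_function \<phi> \<psi> W J \<longleftrightarrow>
    (\<forall>z\<in>W. \<forall>\<^sub>F p in nhds (0, z). J ((\<lambda>g (x, u). (\<phi> g x, \<psi> g u)) (fst p) (snd p)) = J (snd p))"
  by (auto simp: invariant_function_def case_prod_unfold)

lemma invariant_output_error_iff: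
  fixes \<phi> :: "'g::{topological_group_add, t2_space} \<Rightarrow> real^'n \<Rightarrow> real^'n"
  assumes "open W" "open V"
  shows "invariant_output_error \<phi> \<psi> \<rho> h W V E \<longleftrightarrow>
    output_error (\<lambda>g (x, u). (\<phi> g x, \<psi> g u)) \<rho> h W V (\<lambda>(z, y). E (fst z, snd z, y))"
  using eventually_nhds_assoc[of "\<lambda>g x u y. E (\<phi> g x, \<psi> g u, \<rho> g y) = E (x, u, y)" 0]
  unfolding invariant_output_error_def output_error_def smooth_on_assoc[OF assms, symmetric]
  by (auto simp: case_prod_unfold)

theorem theorem2:
  fixes X :: "(real^'n) set" and U :: "(real^'m) set" and Y :: "(real^'p) set"
    and f :: "(real^'n) \<times> (real^'m) \<Rightarrow> real^'n"
    and h :: "(real^'n) \<times> (real^'m) \<Rightarrow> real^'p"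
    and \<A> :: "('g::{topological_group_add, t2_space, second_countable_topology}, 'r::finite) atlas"
    and \<phi> :: "'g \<Rightarrow> real^'n \<Rightarrow> real^'n"
    and \<psi> :: "'g \<Rightarrow> real^'m \<Rightarrow> real^'m"
    and \<rho> :: "'g \<Rightarrow> real^'p \<Rightarrow> real^'p"
    and D\<^sub>\<phi> :: "('g \<times> (real^'n)) set" and D\<^sub>\<psi> :: "('g \<times> (real^'m)) set"
    and D\<^sub>\<rho> :: "('g \<times> (real^'p)) set"
    and x0 :: "real^'n" and u0 :: "real^'m" and y0 :: "real^'p"
  assumes "CARD('p) \<le> CARD('n)" and "CARD('r) \<le> CARD('n)"
    and dim_k: "CARD('k::finite) = CARD('n) + CARD('m) - CARD('r)"
    and "open X" and "open U" and "open Y"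
    and "smooth_on (X \<times> U) f"
    and "smooth_on (X \<times> U) h" and "h ` (X \<times> U) \<subseteq> Y"
    and "lie_group \<A>"
    and "local_transformation_group \<A> X D\<^sub>\<phi> \<phi>"
    and "local_transformation_group \<A> U D\<^sub>\<psi> \<psi>"
    and "local_transformation_group \<A> Y D\<^sub>\<rho> \<rho>"
    and "full_rank_action \<A> X \<phi>"
    and "invariant_system X U \<phi> \<psi> f"
    and "equivariant_output X U \<phi> \<psi> \<rho> h"
    and "x0 \<in> X" and "u0 \<in> U" and "y0 \<in> Y"
  shows
    "(\<exists>W V E. local_domain X U Y h x0 u0 y0 W V \<and> invariant_output_error \<phi> \<psi> \<rho> h W V E)
     \<and>
     ((\<exists>W (I :: (real^'n) \<times> (real^'m) \<Rightarrow> real^'k).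
         open W \<and> (x0, u0) \<in> W \<and> W \<subseteq> X \<times> U \<and> full_rank_invariant \<phi> \<psi> W I) \<and>
      (\<forall>W (I :: (real^'n) \<times> (real^'m) \<Rightarrow> real^'k).
         open W \<and> W \<subseteq> X \<times> U \<and> full_rank_invariant \<phi> \<psi> W I \<longrightarrow> complete_invariant \<phi> \<psi> W I))
     \<and>
     (\<forall>W V E (I :: (real^'n) \<times> (real^'m) \<Rightarrow> real^'k).
        local_domain X U Y h x0 u0 y0 W V \<and> invariant_output_error \<phi> \<psi> \<rho> h W V E \<and>
        full_rank_invariant \<phi> \<psi> W I \<longrightarrow>
        (\<forall>E'. invariant_output_error \<phi> \<psi> \<rho> h W V E' \<longrightarrow>
           (\<exists>W' V' A B L. local_domain X U Y h x0 u0 y0 W' V' \<and> W' \<subseteq> W \<and> V' \<subseteq> V \<and>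
              error_transformation A B L \<and>
              (\<forall>(x, u)\<in>W'. \<forall>y\<in>V'. I (x, u) \<in> A \<and> E (x, u, y) \<in> B \<and>
                 E' (x, u, y) = L (I (x, u), E (x, u, y))))) \<and>
        (\<forall>A B L. error_transformation A B L \<and>
           (\<forall>(x, u)\<in>W. \<forall>y\<in>V. I (x, u) \<in> A \<and> E (x, u, y) \<in> B) \<longrightarrow>
           invariant_output_error \<phi> \<psi> \<rho> h W V (\<lambda>(x, u, y). L (I (x, u), E (x, u, y)))))"
proof -
  note dims = assms(2,3) and h = assms(8,9) and lie = assms(10)
    and \<phi> = assms(11) and \<psi> = assms(12) and \<rho> = assms(13) and rank = assms(14)
    and equivariant = assms(16) and points = assms(17-19)
  let ?\<tau> = "\<lambda>g (x, u). (\<phi> g x, \<psi> g u)"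
  let ?D = "{(g, x, u). (g, x) \<in> D\<^sub>\<phi> \<and> (g, u) \<in> D\<^sub>\<psi>}"
  have atlas: "smooth_atlas \<A>"
    using lie by (simp add: lie_group_def)
  then have "0 \<in> (\<Union>(C, c)\<in>\<A>. C)"
    by (simp add: smooth_atlas_def)
  then obtain C c where at_zero: "(C, c) \<in> \<A>" "0 \<in> C"
    by blast
  \<comment> \<open>Kept for arbitrary base points: existence and factorization use a box at
    \<open>(x0, u0)\<close>, completeness one at each point in question.\<close>
  note box_at = flow_box_exists_product[OF atlas at_zero \<phi> \<psi> rank _ _ dims]
  obtain S :: "real^'k \<Rightarrow> (real^'n) \<times> (real^'m)" and N
    where "flow_box \<A> C c (X \<times> U) ?D ?\<tau> (x0, u0) S N"
    by (rule box_at[OF points(1,2)])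
  then interpret flow_box \<A> C c "X \<times> U" ?D ?\<tau> "(x0, u0)" S N .
  interpret flow_box_output \<A> C c "X \<times> U" ?D ?\<tau> "(x0, u0)" S N Y D\<^sub>\<rho> \<rho> h
    using \<rho> lie h atlas at_zero by unfold_locales
  have error: "\<exists>W V E. local_domain X U Y h x0 u0 y0 W V \<and> invariant_output_error \<phi> \<psi> \<rho> h W V E"
  proof -
    have "\<forall>\<^sub>F p in nhds (0, z). h (?\<tau> (fst p) (snd p)) = \<rho> (fst p) (h (snd p))" if "z \<in> X \<times> U" for z
      using equivariant that unfolding equivariant_output_def by (auto simp: case_prod_unfold)
    then obtain W V E where W: "open W" "(x0, u0) \<in> W" "W \<subseteq> X \<times> U"
      and V: "open V" "y0 \<in> V" "V \<subseteq> Y" "h ` W \<subseteq> V" and E: "output_error ?\<tau> \<rho> h W V E"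
      by (rule output_error_exists[OF _ points(3)])
    have "invariant_output_error \<phi> \<psi> \<rho> h W V (\<lambda>(x, u, y). E ((x, u), y))"
      unfolding invariant_output_error_iff[OF W(1) V(1)] using E by (simp add: case_prod_unfold)
    with W V show ?thesis
      unfolding local_domain_def by blast
  qed
  have full_rank: "full_rank_invariant \<phi> \<psi> box (\<lambda>z. snd (\<Psi> z))"
    unfolding full_rank_invariant_def invariant_function_iff
  proof (intro conjI ballI)
    show "smooth_on box (\<lambda>z. snd (\<Psi> z))"
      using open_box smooth_\<Psi> by (rule smooth_on_snd)
    show "dim (range (frechet_derivative (\<lambda>z. snd (\<Psi> z)) (at z))) = CARD('k)" if "z \<in> box" for z
      using that by (rule full_rank_coordinate)
    show "\<forall>\<^sub>F p in nhds (0, z). snd (\<Psi> (?\<tau> (fst p) (snd p))) = snd (\<Psi> (snd p))" if "z \<in> box" for z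
      using box_equivariant[OF that] by eventually_elim blast
  qed
  have complete: "complete_invariant \<phi> \<psi> W I"
    if W: "open W" "W \<subseteq> X \<times> U" and I: "full_rank_invariant \<phi> \<psi> W I"
    for W and I :: "(real^'n) \<times> (real^'m) \<Rightarrow> real^'k"
    unfolding complete_invariant_def
  proof (intro allI impI ballI, elim conjE)
    fix W1 z1 and J :: "(real^'n) \<times> (real^'m) \<Rightarrow> real"
    assume W1: "open W1" "W1 \<subseteq> W" and J: "invariant_function \<phi> \<psi> W1 J" and z1: "z1 \<in> W1"
    obtain x u where xu: "z1 = (x, u)" "x \<in> X" "u \<in> U"
      using z1 W1 W by auto
    obtain S :: "real^'k \<Rightarrow> (real^'n) \<times> (real^'m)" and N
      where "flow_box \<A> C c (X \<times> U) ?D ?\<tau> z1 S N"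
      unfolding xu(1) by (rule box_at[OF xu(2,3)])
    then interpret B: flow_box \<A> C c "X \<times> U" ?D ?\<tau> z1 S N .
    note I' = I[unfolded full_rank_invariant_def invariant_function_iff]
    have I1: "smooth_on W1 I" "dim (range (frechet_derivative I (at z1))) = CARD('k)"
      "\<forall>\<^sub>F p in nhds (0, z1). I (?\<tau> (fst p) (snd p)) = I (snd p)"
      using I' W1(2) z1 smooth_on_subset by blast+
    have J1: "\<forall>\<^sub>F p in nhds (0, z1). J (?\<tau> (fst p) (snd p)) = J (snd p)"
      using J z1 unfolding invariant_function_iff by blast
    \<comment> \<open>Using \<open>W1\<close> as the ambient set forces the section \<open>s\<close>
      into the domain of \<open>J\<close>. Then \<open>J\<close> composed with \<open>s\<close> is
      the required function of \<open>I\<close>, smooth whenever \<open>J\<close> is.\<close>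
    obtain A s where A: "open A" "I z1 \<in> A" and s: "smooth_on A s" "s ` A \<subseteq> W1"
      and sI: "\<forall>\<^sub>F z in nhds z1. I z \<in> A \<and> s (I z) = B.foot z"
      by (rule B.invariant_section[OF W1(1) z1 I1(1,3,2)])
    have "\<forall>\<^sub>F z in nhds z1. z \<in> W1 \<and> I z \<in> A \<and> J z = J (s (I z))"
      using eventually_nhds_in_open[OF W1(1) z1] B.eventually_foot[OF J1] sI
      by eventually_elim simp
    then obtain W2 where W2: "open W2" "z1 \<in> W2" "\<And>z. z \<in> W2 \<Longrightarrow> z \<in> W1 \<and> I z \<in> A \<and> J z = J (s (I z))"
      unfolding eventually_nhds by blast
    have "smooth_on A (\<lambda>v. J (s v))" if "smooth_on W1 J"
      by (rule smooth_on_compose[OF A(1) W1(1) s(2,1) that])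
    with W2 A(1) show "\<exists>W2 A F. open W2 \<and> z1 \<in> W2 \<and> W2 \<subseteq> W1 \<and> open A \<and> I ` W2 \<subseteq> A \<and>
        (\<forall>z\<in>W2. J z = F (I z)) \<and> (smooth_on W1 J \<longrightarrow> smooth_on A F)"
      by (intro exI[of _ W2] exI[of _ A] exI[of _ "\<lambda>v. J (s v)"]) blast
  qed
  have errors: "\<exists>W' V' A B L. local_domain X U Y h x0 u0 y0 W' V' \<and> W' \<subseteq> W \<and> V' \<subseteq> V \<and>
      error_transformation A B L \<and>
      (\<forall>(x, u)\<in>W'. \<forall>y\<in>V'. I (x, u) \<in> A \<and> E (x, u, y) \<in> B \<and> E' (x, u, y) = L (I (x, u), E (x, u, y)))"
    if dom: "local_domain X U Y h x0 u0 y0 W V"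
      and E: "invariant_output_error \<phi> \<psi> \<rho> h W V E" and E': "invariant_output_error \<phi> \<psi> \<rho> h W V E'"
      and I: "full_rank_invariant \<phi> \<psi> W I"
    for W V E E' and I :: "(real^'n) \<times> (real^'m) \<Rightarrow> real^'k"
  proof -
    note dom = dom[unfolded local_domain_def]
    have W: "open W" "(x0, u0) \<in> W" "W \<subseteq> X \<times> U" and V: "open V" "y0 \<in> V" "V \<subseteq> Y" and hWV: "h ` W \<subseteq> V"
      using dom by blast+
    have I1: "smooth_on W I" "\<forall>\<^sub>F p in nhds (0, x0, u0). I (?\<tau> (fst p) (snd p)) = I (snd p)"
      "dim (range (frechet_derivative I (at (x0, u0)))) = CARD('k)"
      using I W(2) unfolding full_rank_invariant_def invariant_function_iff by blast+
    obtain W' V' A B L where "open W'" "(x0, u0) \<in> W'" "W' \<subseteq> W" "open V'" "y0 \<in> V'" "V' \<subseteq> V"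
      "h ` W' \<subseteq> V'" "error_transformation A B L"
      and eq: "\<And>z y. z \<in> W' \<Longrightarrow> y \<in> V' \<Longrightarrow> I z \<in> A \<and> (\<lambda>(z, y). E (fst z, snd z, y)) (z, y) \<in> B \<and>
        (\<lambda>(z, y). E' (fst z, snd z, y)) (z, y) = L (I z, (\<lambda>(z, y). E (fst z, snd z, y)) (z, y))"
      by (rule output_error_factors[OF E[unfolded invariant_output_error_iff[OF W(1) V(1)]]
            E'[unfolded invariant_output_error_iff[OF W(1) V(1)]] W V hWV I1]) blast
    moreover have "\<forall>(x, u)\<in>W'. \<forall>y\<in>V'. I (x, u) \<in> A \<and> E (x, u, y) \<in> B \<and>
        E' (x, u, y) = L (I (x, u), E (x, u, y))"
      using eq by fastforce
    ultimately show ?thesis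
      using W V by (intro exI[of _ W'] exI[of _ V'] exI[of _ A] exI[of _ B] exI[of _ L])
        (auto simp: local_domain_def)
  qed
  have transformed: "invariant_output_error \<phi> \<psi> \<rho> h W V (\<lambda>(x, u, y). L (I (x, u), E (x, u, y)))"
    if dom: "local_domain X U Y h x0 u0 y0 W V"
      and E: "invariant_output_error \<phi> \<psi> \<rho> h W V E" and I: "full_rank_invariant \<phi> \<psi> W I"
      and L: "error_transformation A B L"
      and AB: "\<forall>(x, u)\<in>W. \<forall>y\<in>V. I (x, u) \<in> A \<and> E (x, u, y) \<in> B"
    for W V E A B L and I :: "(real^'n) \<times> (real^'m) \<Rightarrow> real^'k"
  proof -
    have W: "open W" and V: "open V" and hWV: "h ` W \<subseteq> V"
      using dom unfolding local_domain_def by blast+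
    have I1: "smooth_on W I"
      "\<And>z. z \<in> W \<Longrightarrow> \<forall>\<^sub>F p in nhds (0, z). I (?\<tau> (fst p) (snd p)) = I (snd p)"
      using I unfolding full_rank_invariant_def invariant_function_iff by blast+
    note E1 = E[unfolded invariant_output_error_iff[OF W V]]
    have "output_error ?\<tau> \<rho> h W V (\<lambda>p. L (I (fst p), (\<lambda>(z, y). E (fst z, snd z, y)) p))"
      by (rule output_error_transform[OF E1 W V I1 L _ hWV]) (use AB in auto)
    then show ?thesis
      unfolding invariant_output_error_iff[OF W V] by (simp add: case_prod_unfold)
  qed
  show ?thesis
  proof (intro conjI allI impI; (elim conjE)?)
    show "\<exists>W V E. local_domain X U Y h x0 u0 y0 W V \<and> invariant_output_error \<phi> \<psi> \<rho> h W V E"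
      by (rule error)
    show "\<exists>W (I :: (real^'n) \<times> (real^'m) \<Rightarrow> real^'k).
        open W \<and> (x0, u0) \<in> W \<and> W \<subseteq> X \<times> U \<and> full_rank_invariant \<phi> \<psi> W I"
      using full_rank open_box base_in_box box_subset
      by (intro exI[of _ box] exI[of _ "\<lambda>z. snd (\<Psi> z)"] conjI)
  qed (rule complete errors transformed; assumption)+
qed

end
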